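(* Let $G\subset \mathrm{Diff}(\mathbb C^n,0)$ be an irreducible group having a basic set of generators $\{f_1,\ldots,f_{\nu+1}\}$ which all have the same linear part $Df_j(0)=A\in \mathrm{GL}(n,\mathbb C)$, $j=1,\ldots,\nu+1$. Assume that the eigenvalues $\lambda_1,\ldots,\lambda_n$ of $A$ are such that each $\lambda_j$ is a root of unity of order $p^{s_j}$, where $p$ is a single prime number (the same for all $j$) and $s_j\in\mathbb N=\{0,1,2,\ldots\}$. Then $G$ is finite cyclic. Indeed, $G$ is analytically conjugate to the cyclic group generated by a diagonal matrix $\mathrm{diag}(\xi_1,\ldots,\xi_n)$ where each $\xi_j$ is a root of unity of order $p^{r_j}$ for some $r_j\in\mathbb N$.
   Context: $\mathrm{Diff}(\mathbb C^n,0)$ denotes the group (under composition) of germs at $0$ of holomorphic diffeomorphisms of $\mathbb C^n$ fixing the origin. A subgroup $G\subset \mathrm{Diff}(\mathbb C^n,0)$ is called irreducible if it admits a finite set of generators $f_1,\ldots,f_{\nu+1}$ (called a basic set of generators; repetitions $f_i=f_j$ are allowed) such that (a) $f_1\circ f_2\circ\cdots\circ f_{\nu+1}=\mathrm{Id}$, and (b) for all $i,j$, $f_i$ and $f_j$ are conjugate in $G$, i.e. there is $h\in G$ with $f_i\circ h=h\circ f_j$. *)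

theory Defs
  imports "HOL-Analysis.Analysis"
begin

type_synonym 'n cmap = "complex^'n \<Rightarrow> complex^'n"

text \<open>Germs at 0 are represented by functions; two functions define the same
germ iff they agree on a neighbourhood of 0.\<close>
definition germ_eq :: "'n::finite cmap \<Rightarrow> 'n cmap \<Rightarrow> bool" where
  "germ_eq f g \<longleftrightarrow> (\<forall>\<^sub>F x in nhds 0. f x = g x)"

definition holo_near0 :: "'n::finite cmap \<Rightarrow> bool" where
  "holo_near0 f \<longleftrightarrow> (\<exists>e>0. \<forall>x\<in>ball 0 e. \<exists>L. (f has_derivative L) (at x) \<and>
        (\<forall>c v. L (c *s v) = c *s L v))"

definition germ_inverse :: "'n::finite cmap \<Rightarrow> 'n cmap \<Rightarrow> bool" where
  "germ_inverse g f \<longleftrightarrow> g 0 = 0 \<and> holo_near0 g \<and>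
      (\<forall>\<^sub>F x in nhds 0. g (f x) = x) \<and> (\<forall>\<^sub>F x in nhds 0. f (g x) = x)"

definition diff_germ :: "'n::finite cmap \<Rightarrow> bool" where
  "diff_germ f \<longleftrightarrow> f 0 = 0 \<and> holo_near0 f \<and> (\<exists>g. germ_inverse g f)"

text \<open>The subgroup of Diff(C^n,0) generated by a set F of germs, as a set of
representatives closed under germ equality.\<close>
inductive_set gen_group :: "'n::finite cmap set \<Rightarrow> 'n cmap set" for F where
  gen_id: "id \<in> gen_group F"
| gen_mult: "g \<in> gen_group F \<Longrightarrow> f \<in> F \<Longrightarrow> f \<circ> g \<in> gen_group F"
| gen_inv: "g \<in> gen_group F \<Longrightarrow> f \<in> F \<Longrightarrow> germ_inverse h f \<Longrightarrow> h \<circ> g \<in> gen_group F"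
| gen_germ: "g \<in> gen_group F \<Longrightarrow> germ_eq g g' \<Longrightarrow> g' \<in> gen_group F"

definition basic_generators :: "'n::finite cmap set \<Rightarrow> (nat \<Rightarrow> 'n cmap) \<Rightarrow> nat \<Rightarrow> bool" where
  "basic_generators G f \<nu> \<longleftrightarrow>
     (\<forall>i\<in>{1..\<nu>+1}. diff_germ (f i)) \<and>
     G = gen_group (f ` {1..\<nu>+1}) \<and>
     germ_eq (foldr (\<lambda>i g. f i \<circ> g) [1..<\<nu>+2] id) id \<and>
     (\<forall>i\<in>{1..\<nu>+1}. \<forall>j\<in>{1..\<nu>+1}. \<exists>h\<in>G. germ_eq (f i \<circ> h) (h \<circ> f j))"

definition irreducible_group :: "'n::finite cmap set \<Rightarrow> bool" where
  "irreducible_group G \<longleftrightarrow> (\<exists>f \<nu>. basic_generators G f \<nu>)"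

definition is_eigenvalue :: "complex^'n^'n \<Rightarrow> complex \<Rightarrow> bool" where
  "is_eigenvalue A l \<longleftrightarrow> (\<exists>v. v \<noteq> 0 \<and> A *v v = l *s v)"

definition root_of_unity_order :: "complex \<Rightarrow> nat \<Rightarrow> bool" where
  "root_of_unity_order z k \<longleftrightarrow> k > 0 \<and> z ^ k = 1 \<and> (\<forall>m. 0 < m \<and> m < k \<longrightarrow> z ^ m \<noteq> 1)"

definition diag_map :: "('n::finite \<Rightarrow> complex) \<Rightarrow> 'n cmap" where
  "diag_map \<xi> = (\<lambda>x. \<chi> j. \<xi> j * x $ j)"

end

theory Submission
  imports Defs "HOL-Complex_Analysis.Conformal_Mappings"
begin

text \<open>
  By the product relation \<open>A\<close> has finite order, so it is diagonalizable and, by the hypothesis on the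
  eigenvalues, \<open>A ^ q = 1\<close> for a power \<open>q\<close> of \<open>p\<close>. The heart of the proof is that all generators are
  equal as germs. Suppose that they agree up to terms of order \<open>k \<ge> 2\<close>, let \<open>F\<close> be the first one and
  \<open>D i = f i - F\<close>. Modulo order \<open>k + 1\<close> the \<open>D i\<close> generate, under \<open>L Q = A \<circ> Q\<close> and \<open>R Q = Q \<circ> A\<close>, a
  finitely generated torsion-free abelian group \<open>M\<close>. Every element of \<open>G\<close> is a word in the generators,
  hence of the form \<open>F ^ m + Q\<close> with \<open>Q\<close> in \<open>M\<close>, and conjugacy of \<open>f i\<close> and \<open>F\<close> puts \<open>D i\<close> in
  \<open>(R - L) M\<close>. So \<open>M = (R - L) M = (R - L) ^ q M\<close>, which lies in \<open>p M\<close> because \<open>R ^ q = L ^ q = 1\<close>;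
  therefore \<open>M = 0\<close>, and the generators agree up to order \<open>k + 1\<close>. Thus \<open>G\<close> is generated by the single
  germ \<open>F\<close> of finite order, which averaging over its powers conjugates to its linear part.
  No power series in several variables is needed: being \<open>O(|x| ^ k)\<close> is controlled by
  one-variable Cauchy estimates on complex lines.
\<close>

section \<open>Holomorphic germs and their order of vanishing\<close>

abbreviation complex_homogeneous :: "(complex^'n \<Rightarrow> complex^'m) \<Rightarrow> bool" where
  "complex_homogeneous L \<equiv> (\<forall>c v. L (c *s v) = c *s L v)"

text \<open>Big-O of order \<open>k\<close> at 0, standing in for a Taylor expansion that starts in
  degree \<open>k\<close>. The filter is \<open>nhds 0\<close> and not the punctured one, so for
  \<open>k \<ge> 1\<close> the bound also forces \<open>D 0 = 0\<close>.\<close>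

definition vanishes :: "nat \<Rightarrow> ('n::finite) cmap \<Rightarrow> bool" where
  "vanishes k D \<longleftrightarrow> (\<exists>C. \<forall>\<^sub>F x in nhds 0. norm (D x) \<le> C * norm x ^ k)"

lemma holo_near0_iff_eventually:
  "holo_near0 f \<longleftrightarrow> (\<forall>\<^sub>F x in nhds 0. \<exists>L. (f has_derivative L) (at x) \<and> complex_homogeneous L)"
  unfolding holo_near0_def eventually_nhds_metric by (simp add: Ball_def)

lemma holo_near0_continuous: "holo_near0 f \<Longrightarrow> isCont f 0"
  unfolding holo_near0_def by (meson centre_in_ball has_derivative_continuous)

lemma holo_near0_tendsto:
  assumes "holo_near0 f" "f 0 = 0"
  shows "filterlim f (nhds 0) (nhds 0)"
proof -
  have "(f \<longlongrightarrow> f 0) (nhds 0)"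
    using holo_near0_continuous[OF assms(1)] by (simp add: isCont_def tendsto_at_iff_tendsto_nhds)
  thus ?thesis using assms by simp
qed

lemma holo_near0_compose:
  assumes f: "holo_near0 f" and g: "holo_near0 g" "g 0 = 0"
  shows "holo_near0 (f \<circ> g)"
proof -
  have "\<forall>\<^sub>F x in nhds 0. \<exists>L. (f has_derivative L) (at (g x)) \<and> complex_homogeneous L"
    using f unfolding holo_near0_iff_eventually
    by (rule eventually_compose_filterlim[OF _ holo_near0_tendsto[OF g]])
  with g(1) show ?thesis unfolding holo_near0_iff_eventually
  proof eventually_elim
    case (elim x)
    then obtain L M where "(g has_derivative L) (at x)" "complex_homogeneous L"
       "(f has_derivative M) (at (g x))" "complex_homogeneous M" by blast
    thus ?case by (intro exI[of _ "M \<circ> L"]) (auto intro!: diff_chain_at)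
  qed
qed

lemma holo_near0_add:
  assumes "holo_near0 f" "holo_near0 g"
  shows "holo_near0 (\<lambda>x. f x + g x)"
  using assms unfolding holo_near0_iff_eventually
proof eventually_elim
  case (elim x)
  then obtain L M where "(g has_derivative L) (at x)" "complex_homogeneous L"
     "(f has_derivative M) (at x)" "complex_homogeneous M" by blast
  thus ?case by (intro exI[of _ "\<lambda>v. M v + L v"])
      (auto intro!: derivative_intros simp: vector_add_ldistrib)
qed

lemma bounded_linear_matrix_vector: "bounded_linear (\<lambda>v. (A::complex^'n^'m) *v v)"
proof (rule linear_conv_bounded_linear[THEN iffD1], rule linearI)
  show "A *v (r *\<^sub>R v) = r *\<^sub>R (A *v v)" for r v
    by (simp add: vec_eq_iff matrix_vector_mult_def scaleR_sum_right)
qed (simp add: matrix_vector_right_distrib)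

lemma holo_near0_matrix: "holo_near0 (\<lambda>v. (A::complex^'n^'n) *v v)"
  unfolding holo_near0_iff_eventually
  by (intro always_eventually allI exI[of _ "\<lambda>v. A *v v"])
     (simp add: bounded_linear_imp_has_derivative[OF bounded_linear_matrix_vector] vector_scalar_commute)

lemma matrix_scalar: "(mat c :: complex^'n^'n) *v x = c *s x"
  by (simp add: vec_eq_iff matrix_vector_mult_def mat_def if_distrib[of "\<lambda>a. a * _"] cong: if_cong)

lemma holo_near0_id: "holo_near0 id"
  using holo_near0_matrix[of "mat 1"] by (simp add: id_def)

lemma holo_near0_zero: "holo_near0 (\<lambda>x. 0)"
  using holo_near0_matrix[of "mat 0"] by (simp add: matrix_scalar)

lemma holo_near0_scale: "holo_near0 f \<Longrightarrow> f 0 = 0 \<Longrightarrow> holo_near0 (\<lambda>x. c *s f x)"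
  using holo_near0_compose[OF holo_near0_matrix[of "mat c"], of f] by (simp add: matrix_scalar o_def)

lemma holo_near0_diff:
  assumes "holo_near0 f" "holo_near0 g"
  shows "holo_near0 (\<lambda>x. f x - g x)"
  using assms unfolding holo_near0_iff_eventually
proof eventually_elim
  case (elim x)
  then obtain L M where "(g has_derivative L) (at x)" "complex_homogeneous L"
     "(f has_derivative M) (at x)" "complex_homogeneous M" by blast
  thus ?case by (intro exI[of _ "\<lambda>v. M v - L v"])
      (auto intro!: derivative_intros simp: vector_ssub_ldistrib)
qed

text \<open>Agreement near 0 is agreement in a whole neighbourhood of every point close to 0, so
  derivatives at those points transfer too.\<close>

lemma holo_near0_cong:
  assumes "germ_eq f g" "holo_near0 f"
  shows "holo_near0 g"
proof -
  have "\<forall>\<^sub>F x in nhds 0. \<forall>\<^sub>F y in nhds x. f y = g y"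
    using assms(1) unfolding germ_eq_def by (simp add: eventually_eventually)
  with assms(2) show ?thesis unfolding holo_near0_iff_eventually
  proof eventually_elim
    case (elim x)
    moreover have "(g has_derivative L) (at x)" if "(f has_derivative L) (at x)" for L
      using has_derivative_transform_eventually[OF that] elim(2) eventually_nhds_x_imp_x[OF elim(2)]
      by (simp add: eventually_at_filter eventually_mono)
    ultimately show ?case by blast
  qed
qed

section \<open>Restriction to complex lines and Cauchy estimates\<close>

lemma slice_has_field_derivative:
  fixes D :: "'n::finite cmap"
  assumes "(D has_derivative L) (at (y + t *s v))" "complex_homogeneous L"
  shows "((\<lambda>t. D (y + t *s v) $ j) has_field_derivative (L v $ j)) (at t)"
proof -
  have "bounded_linear (\<lambda>s::complex. s *s v)"
    by (rule linear_conv_bounded_linear[THEN iffD1], rule linearI)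
       (auto simp: vec_eq_iff algebra_simps)
  hence "((\<lambda>t. y + t *s v) has_derivative (\<lambda>s. s *s v)) (at t)"
    using has_derivative_add[OF has_derivative_const bounded_linear_imp_has_derivative] by fastforce
  hence "((\<lambda>t. D (y + t *s v)) has_derivative (\<lambda>s. L (s *s v))) (at t)"
    using diff_chain_at[of "\<lambda>t. y + t *s v" _ t D L] assms(1) by (simp add: o_def)
  hence "((\<lambda>t. D (y + t *s v) $ j) has_derivative (\<lambda>s. L (s *s v) $ j)) (at t)"
    by (rule bounded_linear.has_derivative[OF bounded_linear_vec_nth])
  \<comment> \<open>Complex homogeneity of \<open>L\<close> makes the real derivative along the line
    a multiplication by a complex number, that is, a complex derivative.\<close>
  moreover have "(\<lambda>s. L (s *s v) $ j) = (*) (L v $ j)"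
    using assms(2) by (auto simp: fun_eq_iff)
  ultimately show ?thesis by (simp add: has_field_derivative_def)
qed

lemma slice_holomorphic:
  fixes D :: "'n::finite cmap"
  assumes "\<forall>x\<in>ball 0 R. \<exists>L. (D has_derivative L) (at x) \<and> complex_homogeneous L"
    and "\<And>t. t \<in> S \<Longrightarrow> y + t *s v \<in> ball 0 R"
  shows "(\<lambda>t. D (y + t *s v) $ j) holomorphic_on S"
proof (rule holomorphic_onI)
  fix t assume "t \<in> S"
  then obtain L where "(D has_derivative L) (at (y + t *s v))" "complex_homogeneous L"
    using assms by blast
  from slice_has_field_derivative[OF this] show "(\<lambda>t. D (y + t *s v) $ j) field_differentiable at t within S"
    by (meson field_differentiable_at_within field_differentiable_def)
qed

lemma norm_scalar_mult: "norm (c *s (v::complex^'n)) = norm c * norm v"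
  by (simp add: norm_vec_def norm_mult L2_set_right_distrib)

lemma norm_le_card_bound:
  fixes v :: "complex^'n" and B :: real
  assumes "\<And>j. norm (v $ j) \<le> B"
  shows "norm v \<le> CARD('n) * B"
proof -
  have "norm v \<le> (\<Sum>j\<in>UNIV. norm (v $ j))"
    unfolding norm_vec_def by (intro L2_set_le_sum) auto
  also have "\<dots> \<le> CARD('n) * B" using sum_bounded_above[of UNIV "\<lambda>j. norm (v$j)" B] assms by simp
  finally show ?thesis .
qed

text \<open>Each coordinate of \<open>L v\<close> is the derivative at 0 of the slice along
  \<open>v\<close>, to which the one-variable Cauchy inequality applies; passing from coordinates to
  the norm costs the factor \<open>CARD('n)\<close>.\<close>

lemma Cauchy_derivative_bound:
  fixes D :: "'n::finite cmap"
  assumes holo: "\<forall>x\<in>ball 0 R. \<exists>L. (D has_derivative L) (at x) \<and> complex_homogeneous L"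
    and B: "\<forall>x\<in>ball 0 R. norm (D x) \<le> B"
    and y: "y \<in> ball 0 (R/2)"
    and L: "(D has_derivative L) (at y)" "complex_homogeneous L"
  shows "norm (L v) \<le> CARD('n) * (4 * B / R) * norm v"
proof (cases "v = 0")
  case True
  have "L 0 = 0" using L(1) has_derivative_bounded_linear linear_simps(3) by blast
  thus ?thesis using True by simp
next
  case False
  have R: "R > 0" using y by (smt (verit) divide_nonpos_pos mem_ball norm_ge_zero dist_0_norm)
  \<comment> \<open>For \<open>t\<close> of norm at most \<open>r\<close> the point
    \<open>y + t *s v\<close> moves by at most \<open>R/4\<close> away from the half ball, hence
    stays in the ball of radius \<open>R\<close>.\<close>
  define r where "r = R / (4 * norm v)"
  have r: "r > 0" using R False by (simp add: r_def)
  have in_ball: "y + t *s v \<in> ball 0 R" if "t \<in> cball 0 r" for t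
  proof -
    have "norm (y + t *s v) \<le> norm y + norm t * norm v"
      using norm_triangle_ineq[of y "t *s v"] by (simp add: norm_scalar_mult)
    also have "\<dots> \<le> norm y + r * norm v" using that by (intro add_left_mono mult_right_mono) auto
    also have "\<dots> = norm y + R/4" using False by (simp add: r_def)
    also have "\<dots> < R" using y R by simp
    finally show ?thesis by simp
  qed
  have "norm (L v $ j) \<le> 4 * B / R * norm v" for j
  proof -
    let ?h = "\<lambda>t. D (y + t *s v) $ j"
    have h: "?h holomorphic_on cball 0 r"
      by (rule slice_holomorphic[OF holo in_ball])
    have "norm ((deriv ^^ 1) ?h 0) \<le> fact 1 * B / r ^ 1"
    proof (rule Cauchy_inequality[OF _ _ r])
      show "?h holomorphic_on ball 0 r" using h holomorphic_on_subset ball_subset_cball by blast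
      show "continuous_on (cball 0 r) ?h" using h holomorphic_on_imp_continuous_on by blast
      show "cmod (?h x) \<le> B" if "cmod (0 - x) = r" for x
        using B in_ball[of x] that Finite_Cartesian_Product.norm_nth_le[of "D (y + x *s v)" j] by force
    qed
    moreover have "deriv ?h 0 = L v $ j"
      using slice_has_field_derivative[of D L y 0 v j] L by (intro DERIV_imp_deriv) simp
    ultimately show ?thesis using R False by (simp add: r_def field_simps)
  qed
  from norm_le_card_bound[of "L v", OF this] show ?thesis by (simp add: mult.assoc)
qed

text \<open>Mean value inequality on the convex half ball, with the derivative bound of
  \<open>Cauchy_derivative_bound\<close>.\<close>

lemma bounded_holo_lipschitz:
  fixes D :: "'n::finite cmap"
  assumes holo: "\<forall>x\<in>ball 0 R. \<exists>L. (D has_derivative L) (at x) \<and> complex_homogeneous L"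
    and B: "\<forall>x\<in>ball 0 R. norm (D x) \<le> B"
    and yz: "y \<in> ball 0 (R/2)" "z \<in> ball 0 (R/2)"
  shows "norm (D y - D z) \<le> CARD('n) * (4 * B / R) * norm (y - z)"
proof -
  have R: "R > 0" using yz by (smt (verit) divide_nonpos_pos mem_ball norm_ge_zero dist_0_norm)
  have "\<forall>x\<in>ball 0 (R/2). \<exists>L. (D has_derivative L) (at x) \<and> complex_homogeneous L"
    using holo R by (simp add: ball_def)
  then obtain D' where D': "\<And>x. x\<in>ball 0 (R/2) \<Longrightarrow> (D has_derivative D' x) (at x) \<and> complex_homogeneous (D' x)"
    by metis
  have "onorm (D' x) \<le> CARD('n) * (4 * B / R)" if "x \<in> ball 0 (R/2)" for x
    using Cauchy_derivative_bound[OF holo B that] D'[OF that] by (intro onorm_le) auto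
  thus ?thesis
    using differentiable_bound[of "ball 0 (R/2)" D D' "CARD('n) * (4 * B / R)" y z] D' yz
      has_derivative_at_withinI by (metis convex_ball)
qed

section \<open>Calculus of the order of vanishing\<close>

lemma vanishes_nonneg_bound:
  assumes "vanishes k D"
  obtains C where "C > 0" "\<forall>\<^sub>F x in nhds 0. norm (D x) \<le> C * norm x ^ k"
proof -
  obtain C where C: "\<forall>\<^sub>F x in nhds 0. norm (D x) \<le> C * norm x ^ k"
    using assms by (auto simp: vanishes_def)
  have "\<forall>\<^sub>F x in nhds 0. norm (D x) \<le> (\<bar>C\<bar> + 1) * norm x ^ k"
    using C by eventually_elim (meson abs_ge_self le_add_same_cancel1 mult_right_mono norm_ge_zero order_trans zero_le_one zero_le_power)
  with that[of "\<bar>C\<bar> + 1"] show ?thesis by simp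
qed

lemma vanishes_mono:
  assumes "vanishes l D" "k \<le> l"
  shows "vanishes k D"
proof -
  obtain C where C: "C > 0" "\<forall>\<^sub>F x in nhds 0. norm (D x) \<le> C * norm x ^ l"
    using assms vanishes_nonneg_bound by blast
  have "\<forall>\<^sub>F x::complex^'a in nhds 0. norm x < 1"
    unfolding eventually_nhds_metric by (intro exI[of _ 1]) simp
  with C(2) have "\<forall>\<^sub>F x in nhds 0. norm (D x) \<le> C * norm x ^ k"
    by eventually_elim (smt (verit) C(1) assms(2) mult_left_mono norm_ge_zero power_decreasing)
  thus ?thesis by (auto simp: vanishes_def)
qed

lemma vanishes_add:
  assumes "vanishes k D" "vanishes k E"
  shows "vanishes k (\<lambda>x. D x + E x)"
proof -
  obtain B C where "\<forall>\<^sub>F x in nhds 0. norm (D x) \<le> B * norm x ^ k" "\<forall>\<^sub>F x in nhds 0. norm (E x) \<le> C * norm x ^ k"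
    using assms by (auto simp: vanishes_def)
  hence "\<forall>\<^sub>F x in nhds 0. norm (D x + E x) \<le> (B + C) * norm x ^ k"
    by eventually_elim (smt (verit, best) distrib_right norm_triangle_ineq)
  thus ?thesis by (auto simp: vanishes_def)
qed

lemma vanishes_linear:
  assumes "vanishes k D" "bounded_linear a"
  shows "vanishes k (\<lambda>x. a (D x))"
proof -
  obtain C where "\<forall>\<^sub>F x in nhds 0. norm (D x) \<le> C * norm x ^ k" 
    using assms by (auto simp: vanishes_def)
  moreover obtain K where K: "K > 0" "\<And>x. norm (a x) \<le> norm x * K"
    using assms(2) bounded_linear.pos_bounded by blast
  ultimately have "\<forall>\<^sub>F x in nhds 0. norm (a (D x)) \<le> (C * K) * norm x ^ k"
    by (auto elim!: eventually_mono intro: order_trans[OF K(2)] simp: mult.commute mult.left_commute)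
  thus ?thesis by (auto simp: vanishes_def)
qed

lemma vanishes_scaleR: "vanishes k D \<Longrightarrow> vanishes k (\<lambda>x. r *\<^sub>R D x)"
  by (erule vanishes_linear) (rule bounded_linear_scaleR_right)

lemma vanishes_diff: "vanishes k D \<Longrightarrow> vanishes k E \<Longrightarrow> vanishes k (\<lambda>x. D x - E x)"
  using vanishes_add[of k D "\<lambda>x. (-1) *\<^sub>R E x"] vanishes_scaleR[of k E "-1"] by simp

lemma vanishes_zero: "vanishes k (\<lambda>x. 0)"
  unfolding vanishes_def by (rule exI[of _ 0]) simp

lemma vanishes_cong: "germ_eq D E \<Longrightarrow> vanishes k D \<Longrightarrow> vanishes k E"
  unfolding vanishes_def germ_eq_def by (force elim: eventually_elim2)

lemma vanishes_tendsto:
  assumes "vanishes 1 g"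
  shows "filterlim g (nhds 0) (nhds 0)"
proof -
  obtain C where C: "C > 0" "\<forall>\<^sub>F x in nhds 0. norm (g x) \<le> C * norm x ^ 1"
    using assms vanishes_nonneg_bound by blast
  have "((\<lambda>x::complex^'a. C * norm x ^ 1) \<longlongrightarrow> C * norm (0::complex^'a) ^ 1) (nhds 0)"
    by (intro tendsto_intros filterlim_ident)
  with C(2) show ?thesis by (intro tendsto_norm_zero_cancel[of g])
      (auto intro: tendsto_sandwich[of "\<lambda>_. 0" "\<lambda>x. norm (g x)" "nhds 0" "\<lambda>x. C * norm x"])
qed

lemma vanishes_compose:
  assumes D: "vanishes k D" and g: "vanishes 1 g"
  shows "vanishes k (\<lambda>x. D (g x))"
proof -
  obtain C where C: "C > 0" "\<forall>\<^sub>F x in nhds 0. norm (D x) \<le> C * norm x ^ k"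
    using D vanishes_nonneg_bound by blast
  obtain B where B: "B > 0" "\<forall>\<^sub>F x in nhds 0. norm (g x) \<le> B * norm x ^ 1"
    using g vanishes_nonneg_bound by blast
  have "\<forall>\<^sub>F x in nhds 0. norm (D (g x)) \<le> C * norm (g x) ^ k"
    using C(2) vanishes_tendsto[OF g] by (rule eventually_compose_filterlim)
  with B(2) have "\<forall>\<^sub>F x in nhds 0. norm (D (g x)) \<le> (C * B ^ k) * norm x ^ k"
  proof eventually_elim
    case (elim x)
    have "norm (g x) ^ k \<le> (B * norm x) ^ k" using elim(1) by (intro power_mono) auto
    hence "C * norm (g x) ^ k \<le> C * (B * norm x) ^ k" using C(1) by simp
    with elim(2) show ?case by (simp add: power_mult_distrib mult.assoc)
  qed
  thus ?thesis by (auto simp: vanishes_def)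
qed

text \<open>The derivative of a holomorphic map of order \<open>k\<close> has order
  \<open>k - 1\<close>, so a change of order \<open>m\<close> in the argument changes the value to
  order \<open>(k - 1) + m\<close>. This gain is what makes the error terms in compositions
  negligible.\<close>

lemma vanishes_compose_diff:
  fixes D :: "'n::finite cmap"
  assumes holo: "holo_near0 D" and D: "vanishes k D" "k \<ge> 1"
    and g: "vanishes 1 g" and h: "vanishes 1 h" and gh: "vanishes m (\<lambda>x. g x - h x)"
  shows "vanishes (k + m - 1) (\<lambda>x. D (g x) - D (h x))"
proof -
  obtain C where C: "C > 0" "\<forall>\<^sub>F x in nhds 0. norm (D x) \<le> C * norm x ^ k"
    using D vanishes_nonneg_bound by blast
  obtain R0 where R0: "R0 > 0" "\<forall>x\<in>ball 0 R0. \<exists>L. (D has_derivative L) (at x) \<and> complex_homogeneous L"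
      "\<forall>x\<in>ball 0 R0. norm (D x) \<le> C * norm x ^ k"
  proof -
    have "\<forall>\<^sub>F x in nhds 0. (\<exists>L. (D has_derivative L) (at x) \<and> complex_homogeneous L)
        \<and> norm (D x) \<le> C * norm x ^ k"
      using holo C(2) unfolding holo_near0_iff_eventually by (rule eventually_conj)
    then show ?thesis using that unfolding eventually_nhds_metric by auto
  qed
  obtain B1 where B1: "B1 > 0" "\<forall>\<^sub>F x in nhds 0. norm (g x) \<le> B1 * norm x ^ 1"
    using g vanishes_nonneg_bound by blast
  obtain B2 where B2: "B2 > 0" "\<forall>\<^sub>F x in nhds 0. norm (h x) \<le> B2 * norm x ^ 1"
    using h vanishes_nonneg_bound by blast
  obtain B3 where B3: "B3 > 0" "\<forall>\<^sub>F x in nhds 0. norm (g x - h x) \<le> B3 * norm x ^ m"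
    using gh vanishes_nonneg_bound by blast
  define b where "b = B1 + B2"
  have b: "b > 0" using B1 B2 by (simp add: b_def)
  define K where "K = CARD('n) * (4 * C * (3 * b) ^ k / (3 * b)) * B3"
  have "\<forall>\<^sub>F x::complex^'n in nhds 0. norm x < R0 / (3 * b)"
    unfolding eventually_nhds_metric using R0(1) b by (intro exI[of _ "R0/(3*b)"]) simp
  with B1(2) B2(2) B3(2) have "\<forall>\<^sub>F x in nhds 0. norm (D (g x) - D (h x)) \<le> K * norm x ^ (k + m - 1)"
  proof eventually_elim
    case (elim x)
    show ?case
    proof (cases "x = 0")
      case True
      hence "g x = h x" using elim by simp
      moreover have "K \<ge> 0" using C(1) B3(1) b by (simp add: K_def)
      ultimately show ?thesis by simp
    next
      case False
      \<comment> \<open>The ball shrinks with \<open>x\<close>: on it \<open>D\<close> is of size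
        |x|^k, so its Lipschitz constant is of size |x|^(k-1). Since \<open>b * norm x\<close>
        bounds both \<open>g x\<close> and \<open>h x\<close>, the factor 3 puts them into the half
        ball.\<close>
      define R where "R = 3 * b * norm x"
      have R: "R > 0" using False b by (simp add: R_def)
      have "R \<le> R0" using elim b by (simp add: R_def field_simps)
      hence sub: "ball 0 R \<subseteq> (ball 0 R0 :: (complex^'n) set)" by auto
      have bnd: "\<forall>y\<in>ball 0 R. norm (D y) \<le> C * R ^ k"
      proof
        fix y :: "complex^'n" assume y: "y \<in> ball 0 R"
        have "norm (D y) \<le> C * norm y ^ k" using R0(3) sub y by blast
        also have "\<dots> \<le> C * R ^ k" using y C(1) by (intro mult_left_mono power_mono) auto
        finally show "norm (D y) \<le> C * R ^ k" .
      qed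
      have "b * norm x < R/2" using b False by (simp add: R_def)
      moreover have "norm (g x) \<le> b * norm x" "norm (h x) \<le> b * norm x"
        using elim B1(1) B2(1) by (auto simp: b_def distrib_right intro: order_trans)
      ultimately have "g x \<in> ball 0 (R/2)" "h x \<in> ball 0 (R/2)" by auto
      from bounded_holo_lipschitz[OF _ bnd this] R0(2) sub
      have "norm (D (g x) - D (h x)) \<le> CARD('n) * (4 * (C * R ^ k) / R) * norm (g x - h x)" by blast
      also have "\<dots> \<le> CARD('n) * (4 * (C * R ^ k) / R) * (B3 * norm x ^ m)"
        using elim C(1) R by (intro mult_left_mono) auto
      also have "\<dots> = K * (norm x ^ (k - 1) * norm x ^ m)"
        using False b D(2) by (cases k) (auto simp: K_def R_def power_mult_distrib field_simps)
      also have "\<dots> = K * norm x ^ (k + m - 1)" using D(2) by (simp add: power_add[symmetric])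
      finally show ?thesis .
    qed
  qed
  thus ?thesis by (auto simp: vanishes_def)
qed

text \<open>Differentiability at 0 alone would only give o(|x|). For holomorphic \<open>H\<close>,
  Taylor's formula on the line through 0 and \<open>x\<close> gives a quadratic bound, the second
  derivative being controlled by Cauchy's inequality.\<close>

lemma vanishes_2I:
  fixes H :: "'n::finite cmap"
  assumes holo: "holo_near0 H" and "H 0 = 0" and der: "(H has_derivative (\<lambda>_. 0)) (at 0)"
  shows "vanishes 2 H"
proof -
  have "\<forall>\<^sub>F x in nhds 0. norm (H x) < 1"
    using order_tendstoD(2)[OF tendsto_norm[OF holo_near0_tendsto[OF holo assms(2)]]] by simp
  with holo have "\<forall>\<^sub>F x in nhds 0. (\<exists>L. (H has_derivative L) (at x) \<and> complex_homogeneous L) \<and> norm (H x) < 1"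
    unfolding holo_near0_iff_eventually by (rule eventually_conj)
  then obtain R where R: "R > 0" "\<forall>x\<in>ball 0 R. \<exists>L. (H has_derivative L) (at x) \<and> complex_homogeneous L"
      "\<forall>x\<in>ball 0 R. norm (H x) < 1"
    unfolding eventually_nhds_metric by auto
  have "norm (H x) \<le> CARD('n) * (8 / R^2) * norm x ^ 2" if x: "norm x < R / 4" for x
  proof (cases "x = 0")
    case False
    \<comment> \<open>The slice lives on the disc of radius \<open>2 * r\<close>. As
      \<open>r > 2\<close>, the disc of radius \<open>r\<close> about any point of the closed unit
      disc lies inside it, so the second derivative is at most \<open>2 / r\<^sup>2\<close> on the
      unit disc.\<close>
    define r where "r = R / (2 * norm x)"
    have r: "r > 2" using x False by (simp add: r_def field_simps)
    have in_ball: "0 + t *s x \<in> ball 0 R" if "t \<in> ball 0 (2 * r)" for t :: complex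
      using that False R(1) by (auto simp: norm_scalar_mult r_def field_simps)
    have "norm (H x $ j) \<le> 8 / R^2 * norm x ^ 2" for j
    proof -
      let ?h = "\<lambda>t. H (0 + t *s x) $ j"
      have h: "?h holomorphic_on ball 0 (2 * r)"
        by (rule slice_holomorphic[OF R(2) in_ball])
      have sub: "cball s r \<subseteq> ball 0 (2 * r)" if "s \<in> cball 0 1" for s :: complex
      proof
        fix t assume "t \<in> cball s r"
        hence "norm t \<le> norm s + r" by (smt (verit) dist_norm mem_cball norm_minus_commute norm_triangle_sub)
        thus "t \<in> ball 0 (2 * r)" using that r by simp
      qed
      have "norm ((deriv ^^ 0) ?h 1 - (\<Sum>i\<le>1. (deriv ^^ i) ?h 0 * (1 - 0) ^ i / fact i))
           \<le> (2 / r\<^sup>2) * norm (1 - 0 :: complex) ^ Suc 1 / fact 1"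
      proof (rule complex_Taylor)
        show "convex (cball (0::complex) 1)" by simp
        show "((deriv ^^ i) ?h has_field_derivative (deriv ^^ Suc i) ?h s) (at s within cball 0 1)"
          if "s \<in> cball 0 1" "i \<le> 1" for i s
        proof -
          have "(deriv ^^ i) ?h holomorphic_on ball 0 (2*r)"
            by (rule holomorphic_higher_deriv[OF h]) simp
          moreover have "s \<in> ball 0 (2*r)" using sub[OF that(1)] r by (meson centre_in_cball less_eq_real_def order_trans subsetD zero_le_numeral)
          ultimately show ?thesis
            using holomorphic_derivI[of _ "ball 0 (2*r)" s] by (simp add: has_field_derivative_at_within)
        qed
        show "norm ((deriv ^^ Suc 1) ?h s) \<le> 2 / r\<^sup>2" if s: "s \<in> cball 0 1" for s
        proof -
          have "norm ((deriv ^^ 2) ?h s) \<le> fact 2 * 1 / r ^ 2"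
          proof (rule Cauchy_inequality)
            show "?h holomorphic_on ball s r"
              using h sub[OF s] ball_subset_cball by (blast intro: holomorphic_on_subset)
            show "continuous_on (cball s r) ?h"
              using h sub[OF s] by (blast intro: holomorphic_on_imp_continuous_on holomorphic_on_subset)
            show "r > 0" using r by simp
            show "cmod (?h t) \<le> 1" if "cmod (s - t) = r" for t
            proof -
              have "t \<in> cball s r" using that by (simp add: dist_norm)
              hence "norm (H (0 + t *s x)) < 1" using sub[OF s] in_ball R(3) by blast
              thus ?thesis using Finite_Cartesian_Product.norm_nth_le[of "H (0 + t *s x)" j] by linarith
            qed
          qed
          thus ?thesis by (simp add: numeral_2_eq_2)
        qed
      qed auto
      moreover have "deriv ?h 0 = 0"
        using slice_has_field_derivative[of H "\<lambda>_. 0" 0 0 x j] der by (intro DERIV_imp_deriv) simp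
      ultimately have "norm (H x $ j) \<le> 2 / r\<^sup>2" using assms(2) by simp
      also have "\<dots> = 8 / R^2 * norm x ^ 2" using False R(1) by (simp add: r_def field_simps power2_eq_square)
      finally show ?thesis .
    qed
    from norm_le_card_bound[of "H x", OF this] show ?thesis by (simp add: mult.assoc)
  qed (use assms in simp)
  hence "\<forall>\<^sub>F x in nhds 0. norm (H x) \<le> CARD('n) * (8 / R^2) * norm x ^ 2"
    unfolding eventually_nhds_metric using R(1) by (intro exI[of _ "R/4"]) simp
  thus ?thesis unfolding vanishes_def by blast
qed

text \<open>If \<open>D x\<close> were nonzero, a coordinate of the slice along \<open>x\<close>
  would factor as \<open>t ^ n * g t\<close> with \<open>g\<close> zero-free near 0. Vanishing of
  \<open>D\<close> to order \<open>n + 1\<close> forces \<open>g\<close> to tend to 0 there, a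
  contradiction.\<close>

lemma flat_imp_germ_zero:
  fixes D :: "'n::finite cmap"
  assumes holo: "holo_near0 D" and flat: "\<And>k. vanishes k D"
  shows "\<forall>\<^sub>F x in nhds 0. D x = 0"
proof -
  obtain R where R: "R > 0" "\<forall>x\<in>ball 0 R. \<exists>L. (D has_derivative L) (at x) \<and> complex_homogeneous L"
    using holo unfolding holo_near0_def by blast
  have "D x = 0" if x: "norm x < R" for x
  proof (rule ccontr)
    assume "D x \<noteq> 0"
    then obtain j where j: "D x $ j \<noteq> 0" by (auto simp: vec_eq_iff)
    have D0: "D 0 = 0" 
    proof -
      obtain C where "\<forall>\<^sub>F x in nhds 0. norm (D x) \<le> C * norm x ^ 1" 
        using flat[of 1] by (auto simp: vanishes_def)
      from eventually_nhds_x_imp_x[OF this] show ?thesis by simp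
    qed
    with \<open>D x \<noteq> 0\<close> have x0: "norm x > 0" by auto
    let ?h = "\<lambda>t. D (0 + t *s x) $ j"
    let ?S = "ball 0 (R / norm x) :: complex set"
    have h: "?h holomorphic_on ?S"
      using x0 by (intro slice_holomorphic[OF R(2)]) (auto simp: norm_scalar_mult field_simps)
    obtain g r n where g: "0 < n" "0 < r" "ball 0 r \<subseteq> ?S" "g holomorphic_on ball 0 r"
        "\<And>w. w \<in> ball 0 r \<Longrightarrow> ?h w = (w - 0) ^ n * g w" "\<And>w. w \<in> ball 0 r \<Longrightarrow> g w \<noteq> 0"
    proof (rule holomorphic_factor_zero_nonconstant[OF h])
      have S: "0 \<in> ?S" "1 \<in> ?S" using x0 R(1) x by (auto simp: field_simps)
      thus "0 \<in> ?S" by simp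
      show "\<not> ?h constant_on ?S"
        using D0 j S unfolding constant_on_def by (metis vector_smult_lid vector_smult_lzero zero_index add_0)
    qed (use D0 in auto)
    obtain C where C: "C > 0" "\<forall>\<^sub>F x in nhds 0. norm (D x) \<le> C * norm x ^ (Suc n)"
      using flat vanishes_nonneg_bound by blast
    have lim: "filterlim (\<lambda>t::complex. t *s x) (nhds 0) (at 0)"
    proof -
      have "((\<lambda>t::complex. norm t * norm x) \<longlongrightarrow> 0) (at 0)"
        by (intro tendsto_mult_left_zero tendsto_norm_zero tendsto_ident_at)
      thus ?thesis by (intro tendsto_norm_zero_cancel[of "\<lambda>t. t *s x"]) (simp only: norm_scalar_mult)
    qed
    have ev: "\<forall>\<^sub>F t in at 0. norm (g t) \<le> C * norm x ^ Suc n * norm t"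
    proof -
      have "\<forall>\<^sub>F t in at 0. norm (D (t *s x)) \<le> C * norm (t *s x) ^ (Suc n)"
        using C(2) lim by (rule eventually_compose_filterlim)
      moreover have "\<forall>\<^sub>F t::complex in at 0. t \<in> ball 0 r \<and> t \<noteq> 0"
        unfolding eventually_at using g(2) by (intro exI[of _ r]) (auto simp: dist_norm)
      ultimately show ?thesis
      proof eventually_elim
        case (elim t)
        have "norm t ^ n * norm (g t) = norm (?h t)" using g(5)[of t] elim by (simp add: norm_mult norm_power)
        also have "\<dots> \<le> C * norm (t *s x) ^ (Suc n)" using elim Finite_Cartesian_Product.norm_nth_le[of "D (t *s x)" j] by simp
        also have "\<dots> = norm t ^ n * (C * norm x ^ Suc n * norm t)"
          by (simp add: norm_scalar_mult power_mult_distrib)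
        finally show ?case using elim by simp
      qed
    qed
    have "((\<lambda>t. C * norm x ^ Suc n * norm (t::complex)) \<longlongrightarrow> C * norm x ^ Suc n * norm (0::complex)) (at 0)"
      by (intro tendsto_intros)
    hence "(g \<longlongrightarrow> 0) (at 0)"
      using ev by (intro tendsto_norm_zero_cancel[of g])
       (auto intro: tendsto_sandwich[of "\<lambda>_. 0" "\<lambda>x. norm (g x)" "at 0"])
    moreover have "(g \<longlongrightarrow> g 0) (at 0)"
      using g(2,4) by (metis centre_in_ball continuous_on_eq_continuous_at holomorphic_on_imp_continuous_on isCont_def open_ball)
    ultimately have "g 0 = 0" using tendsto_unique by (metis trivial_limit_at)
    thus False using g(2,6) by simp
  qed
  thus ?thesis unfolding eventually_nhds_metric using R(1) by (intro exI[of _ R]) simp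
qed

section \<open>Nakayama's lemma and the commutator with a map of prime power order\<close>

text \<open>The localisation of the integers at the prime \<open>p\<close>, placed inside the reals
  so that its elements act on maps by \<open>*\<^sub>R\<close>.\<close>

definition p_local :: "nat \<Rightarrow> real set" where
  "p_local p = {of_int a / of_int b | a b. \<not> int p dvd b}"

lemma p_localI: "\<not> int p dvd b \<Longrightarrow> of_int a / of_int b \<in> p_local p"
  unfolding p_local_def by blast

lemma p_localE:
  assumes "c \<in> p_local p"
  obtains a b where "c = of_int a / of_int b" "\<not> int p dvd b" "b \<noteq> 0"
  using assms unfolding p_local_def by auto

lemma p_local_of_int:
  assumes "prime p"
  shows "of_int a \<in> p_local p"
  using p_localI[of p 1 a] assms by (auto simp: prime_nat_iff)

lemma p_local_add:
  assumes "prime p" "c \<in> p_local p" "d \<in> p_local p"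
  shows "c + d \<in> p_local p"
proof -
  obtain a b a' b' where *: "c = of_int a / of_int b" "\<not> int p dvd b" "b \<noteq> 0"
      "d = of_int a' / of_int b'" "\<not> int p dvd b'" "b' \<noteq> 0"
    using assms(2,3) by (elim p_localE)
  hence "c + d = of_int (a * b' + a' * b) / of_int (b * b')" by (simp add: field_simps)
  thus ?thesis using * assms(1) p_localI[of p "b * b'" "a * b' + a' * b"] by (simp add: prime_dvd_mult_iff)
qed

lemma p_local_mult:
  assumes "prime p" "c \<in> p_local p" "d \<in> p_local p"
  shows "c * d \<in> p_local p"
proof -
  obtain a b a' b' where *: "c = of_int a / of_int b" "\<not> int p dvd b"
      "d = of_int a' / of_int b'" "\<not> int p dvd b'"
    using assms(2,3) by (elim p_localE)
  hence "c * d = of_int (a * a') / of_int (b * b')" by simp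
  thus ?thesis using * assms(1) p_localI[of p "b * b'" "a * a'"] by (simp add: prime_dvd_mult_iff)
qed

text \<open>The numerator \<open>b - p a\<close> of \<open>1 - p c\<close> stays prime to
  \<open>p\<close> along with \<open>b\<close>. So \<open>1 - p c\<close> is a unit of the local
  ring, which is what lets a generator be eliminated.\<close>

lemma p_local_one_minus:
  assumes "prime p" "c \<in> p_local p"
  shows "1 - of_nat p * c \<noteq> 0" "1 / (1 - of_nat p * c) \<in> p_local p"
proof -
  obtain a b where *: "c = of_int a / of_int b" "\<not> int p dvd b" "b \<noteq> 0"
    using assms(2) by (elim p_localE)
  have nd: "\<not> int p dvd b - int p * a" using *(2) by (simp add: dvd_diff_left_iff)
  hence "b - int p * a \<noteq> 0" by auto
  hence nz: "real_of_int (b - int p * a) \<noteq> 0" by linarith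
  have eq: "1 - of_nat p * c = of_int (b - int p * a) / of_int b" using * by (simp add: field_simps)
  show "1 - of_nat p * c \<noteq> 0" unfolding eq using nz *(3) by simp
  have "1 / (1 - of_nat p * c) = of_int b / of_int (b - int p * a)" unfolding eq by simp
  thus "1 / (1 - of_nat p * c) \<in> p_local p" using p_localI[OF nd] by simp
qed

text \<open>\<open>W\<close> collects the maps counted as zero (later those vanishing to order
  \<open>k + 1\<close>), and congruence modulo \<open>W\<close> replaces a quotient. Closure under
  real scalars makes that quotient torsion-free and allows division by units.\<close>

locale stable_subspace =
  fixes a :: "'v::real_vector \<Rightarrow> 'v" and W :: "('v \<Rightarrow> 'v) set"
  assumes linear: "linear a"
    and zero: "(\<lambda>x. 0) \<in> W"
    and add: "P \<in> W \<Longrightarrow> Q \<in> W \<Longrightarrow> (\<lambda>x. P x + Q x) \<in> W"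
    and scale: "P \<in> W \<Longrightarrow> (\<lambda>x. r *\<^sub>R P x) \<in> W"
    and left: "P \<in> W \<Longrightarrow> (\<lambda>x. a (P x)) \<in> W"
    and right: "P \<in> W \<Longrightarrow> (\<lambda>x. P (a x)) \<in> W"
begin

lemma sum_mem: "finite J \<Longrightarrow> (\<And>j. j \<in> J \<Longrightarrow> P j \<in> W) \<Longrightarrow> (\<lambda>x. \<Sum>j\<in>J. P j x) \<in> W"
  by (induction J rule: finite_induct) (auto intro: zero add)

text \<open>Nakayama's lemma for a finitely generated module over the integers localised at \<open>p\<close>,
  by eliminating one generator at a time: \<open>1 - p c\<close> is a unit.\<close>

lemma nakayama:
  fixes E :: "'j \<Rightarrow> 'v \<Rightarrow> 'v"
  assumes "finite J" "prime p"
    and "\<And>j h. j \<in> J \<Longrightarrow> h \<in> J \<Longrightarrow> c j h \<in> p_local p"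
    and "\<And>j. j \<in> J \<Longrightarrow> (\<lambda>x. E j x - (\<Sum>h\<in>J. (of_nat p * c j h) *\<^sub>R E h x)) \<in> W"
  shows "\<forall>j\<in>J. E j \<in> W"
  using assms(1,3,4)
proof (induction J arbitrary: c rule: finite_induct)
  case (insert y J)
  define u where "u = 1 / (1 - of_nat p * c y y)"
  have cyy: "c y y \<in> p_local p" using insert.prems by simp
  note u = p_local_one_minus[OF assms(2) cyy]
  \<comment> \<open>Solving the relation of \<open>y\<close> for \<open>E y\<close> and substituting
    into that of \<open>j\<close> adds \<open>(p c j y) u (p c y h)\<close> to the coefficient
    \<open>p c j h\<close>. One factor \<open>p\<close> is split off, the other is kept in
    \<open>c'\<close>.\<close>
  define c' where "c' j h = c j h + of_int (int p) * c j y * u * c y h" for j h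
  let ?R = "\<lambda>j x. E j x - (\<Sum>h\<in>insert y J. (of_nat p * c j h) *\<^sub>R E h x)"
  have R: "?R j \<in> W" if "j \<in> insert y J" for j using insert.prems(2)[OF that] .
  have Ey: "E y x = u *\<^sub>R (?R y x + (\<Sum>h\<in>J. (of_nat p * c y h) *\<^sub>R E h x))" for x
  proof -
    have "?R y x + (\<Sum>h\<in>J. (of_nat p * c y h) *\<^sub>R E h x) = (1 - of_nat p * c y y) *\<^sub>R E y x"
      using insert.hyps by (simp add: algebra_simps)
    thus ?thesis using u(1) by (simp add: u_def)
  qed
  have IH: "\<forall>j\<in>J. E j \<in> W"
  proof (rule insert.IH[of c'])
    fix j h assume "j \<in> J" "h \<in> J"
    thus "c' j h \<in> p_local p" unfolding c'_def u_def
      using insert.prems(1) u(2) by (intro p_local_add p_local_mult p_local_of_int assms(2)) auto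
  next
    fix j assume j: "j \<in> J"
    have "E j x - (\<Sum>h\<in>J. (of_nat p * c' j h) *\<^sub>R E h x) = ?R j x + (of_nat p * c j y * u) *\<^sub>R ?R y x" for x
    proof -
      have "?R j x = E j x - (of_nat p * c j y) *\<^sub>R E y x - (\<Sum>h\<in>J. (of_nat p * c j h) *\<^sub>R E h x)"
        using insert.hyps by (simp add: algebra_simps)
      moreover have "(of_nat p * c j y) *\<^sub>R E y x = (of_nat p * c j y * u) *\<^sub>R ?R y x
         + (\<Sum>h\<in>J. (of_nat p * (of_int (int p) * c j y * u * c y h)) *\<^sub>R E h x)"
        by (subst Ey) (simp add: scaleR_add_right scaleR_sum_right mult_ac)
      ultimately show ?thesis
        by (simp add: c'_def ring_distribs scaleR_add_left sum.distrib)
    qed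
    moreover have "(\<lambda>x. ?R j x + (of_nat p * c j y * u) *\<^sub>R ?R y x) \<in> W"
      using R j by (intro add scale) auto
    ultimately show "(\<lambda>x. E j x - (\<Sum>h\<in>J. (of_nat p * c' j h) *\<^sub>R E h x)) \<in> W" by presburger
  qed
  have "(\<lambda>x. u *\<^sub>R (?R y x + (\<Sum>h\<in>J. (of_nat p * c y h) *\<^sub>R E h x))) \<in> W"
    using IH R insert.hyps by (intro add scale sum_mem) auto
  hence "E y \<in> W" by (subst (asm) Ey[symmetric])
  with IH show ?case by simp
qed simp

end

text \<open>The group \<open>M\<close> of the overview: for linear \<open>a\<close>, the integer
  combinations of the maps \<open>a ^^ s \<circ> D i \<circ> a ^^ t\<close>. Real scaling is
  deliberately excluded, since otherwise divisibility by \<open>p\<close> would carry no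
  information.\<close>

inductive_set orbit_span :: "('v \<Rightarrow> 'v::real_vector) \<Rightarrow> 'i set \<Rightarrow> ('i \<Rightarrow> 'v \<Rightarrow> 'v) \<Rightarrow> ('v \<Rightarrow> 'v) set"
  for a I D where
  zero: "(\<lambda>x. 0) \<in> orbit_span a I D"
| gen: "i \<in> I \<Longrightarrow> D i \<in> orbit_span a I D"
| diff: "P \<in> orbit_span a I D \<Longrightarrow> Q \<in> orbit_span a I D \<Longrightarrow> (\<lambda>x. P x - Q x) \<in> orbit_span a I D"
| left: "Q \<in> orbit_span a I D \<Longrightarrow> (\<lambda>x. a (Q x)) \<in> orbit_span a I D"
| right: "Q \<in> orbit_span a I D \<Longrightarrow> (\<lambda>x. Q (a x)) \<in> orbit_span a I D"

lemma orbit_span_add: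
  assumes "P \<in> orbit_span a I D" "Q \<in> orbit_span a I D"
  shows "(\<lambda>x. P x + Q x) \<in> orbit_span a I D"
  using orbit_span.diff[OF assms(1) orbit_span.diff[OF orbit_span.zero assms(2)]] by simp

lemma orbit_span_sum:
  "finite J \<Longrightarrow> (\<And>j. j \<in> J \<Longrightarrow> P j \<in> orbit_span a I D) \<Longrightarrow> (\<lambda>x. \<Sum>j\<in>J. P j x) \<in> orbit_span a I D"
  by (induction J rule: finite_induct) (auto intro: orbit_span.zero orbit_span_add)

lemma orbit_span_scale_int:
  assumes "Q \<in> orbit_span a I D"
  shows "(\<lambda>x. of_int n *\<^sub>R Q x) \<in> orbit_span a I D"
proof (cases n rule: int_cases2)
  case (nonneg m)
  have "(\<lambda>x. \<Sum>j<m. Q x) \<in> orbit_span a I D" using assms by (intro orbit_span_sum) auto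
  thus ?thesis using nonneg by (simp add: sum_constant_scaleR)
next
  case (nonpos m)
  have "(\<lambda>x. 0 - (\<Sum>j<m. Q x)) \<in> orbit_span a I D"
    using assms by (intro orbit_span.diff orbit_span.zero orbit_span_sum) auto
  thus ?thesis using nonpos by (simp add: sum_constant_scaleR)
qed

lemma orbit_span_left_pow: "Q \<in> orbit_span a I D \<Longrightarrow> (\<lambda>x. (a ^^ n) (Q x)) \<in> orbit_span a I D"
  by (induction n) (auto intro: orbit_span.left)

lemma orbit_span_right_pow:
  assumes "Q \<in> orbit_span a I D"
  shows "(\<lambda>x. Q ((a ^^ n) x)) \<in> orbit_span a I D"
proof (induction n)
  case (Suc n)
  from orbit_span.right[OF Suc] show ?case by (simp add: funpow_swap1)
qed (simp add: assms)

lemma funpow_mod_id: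
  assumes "a ^^ q = id"
  shows "a ^^ (n mod q) = a ^^ n"
proof -
  have "a ^^ n = a ^^ (n mod q + q * (n div q))" by simp
  also have "\<dots> = a ^^ (n mod q) \<circ> (a ^^ q) ^^ (n div q)" by (simp only: funpow_add funpow_mult)
  also have "\<dots> = a ^^ (n mod q)" using assms by simp
  finally show ?thesis by simp
qed

text \<open>As \<open>a ^^ q = id\<close>, the exponents on both sides count only modulo
  \<open>q\<close>, so finitely many maps generate. Linearity of \<open>a\<close> keeps integer
  combinations closed under composition on the left.\<close>

lemma orbit_span_finite_combination:
  fixes a :: "'v::real_vector \<Rightarrow> 'v"
  assumes "linear a" "finite I" "a ^^ q = id" "q > 0" "Q \<in> orbit_span a I D"
  shows "\<exists>c. Q = (\<lambda>x. \<Sum>(i,s,t)\<in>I \<times> {..<q} \<times> {..<q}. of_int (c (i,s,t)) *\<^sub>R (a ^^ s) (D i ((a ^^ t) x)))"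
proof -
  define J where "J = I \<times> {..<q} \<times> {..<q}"
  define E where "E = (\<lambda>(i,s,t) x. (a ^^ s) (D i ((a ^^ t) x)))"
  define Z where "Z = {(\<lambda>x. \<Sum>j\<in>J. of_int (c j) *\<^sub>R E j x) |c. True}"
  have J: "finite J" using assms by (simp add: J_def)
  have Z0: "(\<lambda>x. 0) \<in> Z" unfolding Z_def by (auto intro!: exI[of _ "\<lambda>_. 0"])
  have Zlin: "(\<lambda>x. P x + of_int n *\<^sub>R Q x) \<in> Z" if PQ: "P \<in> Z" "Q \<in> Z" for P Q n
  proof -
    obtain c d where "P = (\<lambda>x. \<Sum>j\<in>J. of_int (c j) *\<^sub>R E j x)" "Q = (\<lambda>x. \<Sum>j\<in>J. of_int (d j) *\<^sub>R E j x)"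
      using PQ unfolding Z_def by blast
    hence "(\<lambda>x. P x + of_int n *\<^sub>R Q x) = (\<lambda>x. \<Sum>j\<in>J. of_int (c j + n * d j) *\<^sub>R E j x)"
      by (simp add: scaleR_add_left sum.distrib scaleR_sum_right)
    thus ?thesis unfolding Z_def mem_Collect_eq by (intro exI[of _ "\<lambda>j. c j + n * d j"]) simp
  qed
  have Zsum: "(\<lambda>x. \<Sum>j\<in>K. of_int (c j) *\<^sub>R F j x) \<in> Z" if "finite K" "\<And>j. j \<in> K \<Longrightarrow> F j \<in> Z" for K c and F :: "_ \<Rightarrow> 'v \<Rightarrow> 'v"
    using that by (induction K rule: finite_induct) (auto simp: Z0 add.commute[of "_ *\<^sub>R _"] intro: Zlin)
  have ZE: "E j \<in> Z" if "j \<in> J" for j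
  proof -
    have "E j = (\<lambda>x. \<Sum>k\<in>J. of_int (if k = j then 1 else 0) *\<^sub>R E k x)"
      using that J by (simp add: if_distrib[of "\<lambda>r. r *\<^sub>R _"] if_distrib[of real_of_int] cong: if_cong)
    thus ?thesis unfolding Z_def mem_Collect_eq by (intro exI[of _ "\<lambda>k. if k = j then 1 else 0"]) simp
  qed
  have "Q \<in> Z" using assms(5)
  proof (induction rule: orbit_span.induct)
    case zero
    show ?case by (rule Z0)
  next
    case (gen i)
    with ZE[of "(i,0,0)"] assms(4) show ?case by (simp add: J_def E_def)
  next
    case (diff P Q)
    with Zlin[of P Q "-1"] show ?case by simp
  next
    case (left Q)
    then obtain c where c: "Q = (\<lambda>x. \<Sum>j\<in>J. of_int (c j) *\<^sub>R E j x)" unfolding Z_def by blast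
    have "(\<lambda>x. a (E j x)) \<in> Z" if "j \<in> J" for j
    proof -
      obtain i s t where j: "j = (i,s,t)" by (cases j)
      have "(\<lambda>x. a (E j x)) = E (i, Suc s mod q, t)" by (simp add: E_def j funpow_mod_id[OF assms(3)])
      thus ?thesis using ZE[of "(i, Suc s mod q, t)"] that j assms(4) by (simp add: J_def)
    qed
    from Zsum[OF J this] show ?case
      unfolding c by (simp add: linear_sum[OF assms(1)] linear_scale[OF assms(1)])
  next
    case (right Q)
    then obtain c where c: "Q = (\<lambda>x. \<Sum>j\<in>J. of_int (c j) *\<^sub>R E j x)" unfolding Z_def by blast
    have "(\<lambda>x. E j (a x)) \<in> Z" if "j \<in> J" for j
    proof -
      obtain i s t where j: "j = (i,s,t)" by (cases j)
      have "(\<lambda>x. E j (a x)) = E (i, s, Suc t mod q)"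
        by (simp add: E_def j funpow_mod_id[OF assms(3)] funpow_swap1)
      thus ?thesis using ZE[of "(i, s, Suc t mod q)"] that j assms(4) by (simp add: J_def)
    qed
    from Zsum[OF J this] show ?case unfolding c by simp
  qed
  thus ?thesis unfolding Z_def J_def E_def by (auto simp: case_prod_unfold)
qed

section \<open>Powers of the commutator modulo a prime\<close>

lemma prime_dvd_choose_power:
  assumes "prime (p::nat)" "0 < j" "j < p ^ s"
  shows "p dvd (p ^ s choose j)"
proof (rule ccontr)
  assume "\<not> p dvd (p ^ s choose j)"
  hence "coprime (p ^ s) (p ^ s choose j)" using assms(1) by (simp add: prime_imp_coprime)
  \<comment> \<open>Absorption identity \<open>j * (q choose j) = q * (q - 1 choose j - 1)\<close>
    for \<open>q = p ^ s\<close>: were the binomial coefficient prime to \<open>p\<close>, all of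
    \<open>q\<close> would divide \<open>j\<close>, which is positive and smaller.\<close>
  moreover have "p ^ s dvd j * (p ^ s choose j)"
    using times_binomial_minus1_eq[of j "p ^ s"] assms(2) by simp
  ultimately have "p ^ s dvd j" by (simp add: coprime_dvd_mult_left_iff)
  thus False using assms(2,3) by (simp add: nat_dvd_not_less)
qed

text \<open>Pascal's rule for alternating sums; the difference \<open>T j - T (Suc j)\<close> is the
  effect of one more factor \<open>R - L\<close> on the term \<open>T j\<close>.\<close>

lemma alternating_pascal:
  fixes T :: "nat \<Rightarrow> 'v::real_vector"
  shows "(\<Sum>j\<le>n. ((-1) ^ j * real (n choose j)) *\<^sub>R (T j - T (Suc j)))
    = (\<Sum>j\<le>Suc n. ((-1) ^ j * real (Suc n choose j)) *\<^sub>R T j)"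
proof -
  have "(\<Sum>j\<le>Suc n. ((-1) ^ j * real (Suc n choose j)) *\<^sub>R T j)
      = T 0 + (\<Sum>j\<le>n. ((-1) ^ Suc j * real (Suc n choose Suc j)) *\<^sub>R T (Suc j))"
    by (subst sum.atMost_Suc_shift) simp
  also have "(\<Sum>j\<le>n. ((-1) ^ Suc j * real (Suc n choose Suc j)) *\<^sub>R T (Suc j))
      = (\<Sum>j\<le>n. ((-1) ^ Suc j * real (n choose Suc j)) *\<^sub>R T (Suc j))
        - (\<Sum>j\<le>n. ((-1) ^ j * real (n choose j)) *\<^sub>R T (Suc j))"
    unfolding sum_subtractf[symmetric] by (intro sum.cong refl) (simp add: algebra_simps)
  also have "T 0 + \<dots> = (\<Sum>j\<le>Suc n. ((-1) ^ j * real (n choose j)) *\<^sub>R T j)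
        - (\<Sum>j\<le>n. ((-1) ^ j * real (n choose j)) *\<^sub>R T (Suc j))"
    by (subst sum.atMost_Suc_shift) simp
  also have "\<dots> = (\<Sum>j\<le>n. ((-1) ^ j * real (n choose j)) *\<^sub>R (T j - T (Suc j)))"
    by (simp add: sum_subtractf algebra_simps)
  finally show ?thesis by simp
qed

definition commutator_op :: "('v \<Rightarrow> 'v) \<Rightarrow> ('v \<Rightarrow> 'v) \<Rightarrow> 'v \<Rightarrow> 'v::real_vector" where
  "commutator_op a Q = (\<lambda>x. Q (a x) - a (Q x))"

text \<open>Composition with \<open>a\<close> on the left commutes with composition on the right, so
  this is the binomial theorem for the \<open>n\<close>th power of \<open>R - L\<close>.\<close>

lemma commutator_op_funpow:
  assumes "linear a"
  shows "(commutator_op a ^^ n) Q =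
    (\<lambda>x. \<Sum>j\<le>n. ((-1) ^ j * real (n choose j)) *\<^sub>R (a ^^ j) (Q ((a ^^ (n - j)) x)))"
proof (induction n)
  case (Suc n)
  show ?case
  proof
    fix x
    let ?T = "\<lambda>j. (a ^^ j) (Q ((a ^^ (Suc n - j)) x))"
    have "(commutator_op a ^^ Suc n) Q x =
      (\<Sum>j\<le>n. ((-1) ^ j * real (n choose j)) *\<^sub>R (a ^^ j) (Q ((a ^^ (n - j)) (a x))))
      - a (\<Sum>j\<le>n. ((-1) ^ j * real (n choose j)) *\<^sub>R (a ^^ j) (Q ((a ^^ (n - j)) x)))"
      by (simp add: Suc commutator_op_def)
    also have "\<dots> = (\<Sum>j\<le>n. ((-1) ^ j * real (n choose j)) *\<^sub>R (?T j - ?T (Suc j)))"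
      unfolding linear_sum[OF assms] linear_scale[OF assms] sum_subtractf[symmetric] scaleR_diff_right[symmetric]
      by (intro sum.cong refl) (simp add: Suc_diff_le funpow_swap1)
    finally show "(commutator_op a ^^ Suc n) Q x = (\<Sum>j\<le>Suc n. ((-1) ^ j * real (Suc n choose j)) *\<^sub>R ?T j)"
      using alternating_pascal[of n ?T] by simp
  qed
qed simp

text \<open>Freshman's dream: writing \<open>R Q = Q \<circ> a\<close> and \<open>L Q = a \<circ> Q\<close>, modulo \<open>p\<close> the power
  \<open>(R - L)^q\<close> is \<open>R^q - L^q = 0\<close>.\<close>

lemma commutator_op_prime_power:
  assumes a: "linear a" "a ^^ (p ^ s) = id" and p: "prime p" and Q: "Q \<in> orbit_span a I D"
  shows "\<exists>Q'\<in>orbit_span a I D. (commutator_op a ^^ (p ^ s)) Q = (\<lambda>x. real p *\<^sub>R Q' x)"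
proof -
  define q where "q = p ^ s"
  have q: "q > 0" using p by (simp add: q_def prime_gt_0_nat)
  \<comment> \<open>The term \<open>j = q\<close> equals the term \<open>j = 0\<close> because
    \<open>a ^^ q = id\<close>, so the two are merged into the coefficient
    \<open>1 + (-1) ^ q\<close>: it is 0 for odd \<open>q\<close>, and 2 for even \<open>q\<close>,
    where \<open>p = 2\<close>.\<close>
  define d :: "nat \<Rightarrow> int" where
    "d j = (if j = 0 then 1 + (-1) ^ q else (-1) ^ j * int (q choose j))" for j
  let ?T = "\<lambda>j x. (a ^^ j) (Q ((a ^^ (q - j)) x))"
  have dvd: "int p dvd d j" if "j < q" for j
  proof (cases "j = 0")
    case True
    have "int p dvd 1 + (-1) ^ q"
    proof (cases "even q")
      case True
      hence "even p" using p q unfolding q_def by (cases s) auto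
      hence "p = 2" using p primes_dvd_imp_eq two_is_prime_nat by blast
      thus ?thesis using True by simp
    qed simp
    thus ?thesis using True by (simp add: d_def)
  next
    case False
    have "int p dvd int (q choose j)"
      using prime_dvd_choose_power[OF p, of j s] False that unfolding q_def by simp
    thus ?thesis using False by (simp add: d_def)
  qed
  define Q' where "Q' = (\<lambda>x. \<Sum>j<q. of_int (d j div int p) *\<^sub>R ?T j x)"
  have "Q' \<in> orbit_span a I D"
    unfolding Q'_def
    by (intro orbit_span_sum orbit_span_scale_int orbit_span_left_pow orbit_span_right_pow[of "\<lambda>x. Q x"])
       (auto simp: Q)
  moreover have "(commutator_op a ^^ q) Q x = real p *\<^sub>R Q' x" for x
  proof -
    have "(commutator_op a ^^ q) Q x = (\<Sum>j\<le>q. ((-1) ^ j * real (q choose j)) *\<^sub>R ?T j x)"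
      by (simp add: commutator_op_funpow[OF a(1)])
    also have "\<dots> = (\<Sum>j<q. ((-1) ^ j * real (q choose j)) *\<^sub>R ?T j x) + (-1) ^ q *\<^sub>R ?T q x"
      by (simp add: lessThan_Suc_atMost[symmetric])
    also have "?T q x = ?T 0 x" using a(2) by (simp add: q_def)
    also have "(\<Sum>j<q. ((-1) ^ j * real (q choose j)) *\<^sub>R ?T j x) + (-1) ^ q *\<^sub>R ?T 0 x
       = (\<Sum>j<q. of_int (d j) *\<^sub>R ?T j x)"
    proof -
      obtain r where r: "q = Suc r" using q gr0_implies_Suc by blast
      have "of_int (d 0) *\<^sub>R ?T 0 x = ?T 0 x + (-1) ^ q *\<^sub>R ?T 0 x"
        by (simp add: d_def scaleR_add_left)
      moreover have "of_int (d (Suc j)) = ((-1) ^ Suc j * real (q choose Suc j))" for j by (simp add: d_def)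
      ultimately show ?thesis unfolding r sum.lessThan_Suc_shift by (simp add: r)
    qed
    also have "\<dots> = real p *\<^sub>R Q' x"
    proof -
      have "of_int (d j) *\<^sub>R ?T j x = (real p * of_int (d j div int p)) *\<^sub>R ?T j x" if "j < q" for j
      proof -
        have "d j = int p * (d j div int p)" using dvd[OF that] by simp
        hence "real_of_int (d j) = real p * of_int (d j div int p)" by (metis of_int_mult of_int_of_nat_eq)
        thus ?thesis by simp
      qed
      thus ?thesis unfolding Q'_def scaleR_sum_right scaleR_scaleR by (intro sum.cong refl) simp
    qed
    finally show ?thesis .
  qed
  ultimately show ?thesis unfolding q_def by blast
qed

lemma (in stable_subspace) diff: "P \<in> W \<Longrightarrow> Q \<in> W \<Longrightarrow> (\<lambda>x. P x - Q x) \<in> W"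
  using add[of P "\<lambda>x. (-1) *\<^sub>R Q x"] scale[of Q "-1"] by simp

lemma (in stable_subspace) orbit_span_collapse:
  assumes p: "prime p" and ord: "a ^^ (p ^ s) = id" and I: "finite I"
    and comm: "\<And>i. i \<in> I \<Longrightarrow> \<exists>Q\<in>orbit_span a I D. (\<lambda>x. D i x - commutator_op a Q x) \<in> W"
  shows "\<forall>i\<in>I. D i \<in> W"
proof -
  let ?M = "orbit_span a I D" and ?U = "commutator_op a"
  have U_diff: "?U (\<lambda>x. P x - Q x) = (\<lambda>x. ?U P x - ?U Q x)" for P Q
    by (auto simp: commutator_op_def linear_diff[OF linear])
  have U_W: "?U P \<in> W" if "P \<in> W" for P
    unfolding commutator_op_def using that by (intro diff left right)
  \<comment> \<open>The hypothesis on the generators spreads to the whole group because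
    \<open>R - L\<close> is additive and commutes with \<open>L\<close> and
    \<open>R\<close>.\<close>
  have step: "\<exists>Q\<in>?M. (\<lambda>x. P x - ?U Q x) \<in> W" if "P \<in> ?M" for P
    using that
  proof (induction rule: orbit_span.induct)
    case zero
    have "(\<lambda>x. 0 - ?U (\<lambda>x. 0) x) \<in> W" using stable_subspace.zero[OF stable_subspace_axioms] by (simp add: commutator_op_def linear_0[OF linear])
    thus ?case using orbit_span.zero by blast
  next
    case (gen i)
    thus ?case by (rule comm)
  next
    case (diff P Q)
    then obtain P' Q' where *: "P' \<in> ?M" "Q' \<in> ?M" "(\<lambda>x. P x - ?U P' x) \<in> W" "(\<lambda>x. Q x - ?U Q' x) \<in> W"
      by blast
    have "(\<lambda>x. (P x - Q x) - ?U (\<lambda>x. P' x - Q' x) x) \<in> W"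
      using stable_subspace.diff[OF stable_subspace_axioms *(3,4)] by (simp add: U_diff algebra_simps)
    thus ?case using orbit_span.diff[OF *(1,2)] by blast
  next
    case (left P)
    then obtain P' where *: "P' \<in> ?M" "(\<lambda>x. P x - ?U P' x) \<in> W" by blast
    have "(\<lambda>x. a (P x) - ?U (\<lambda>x. a (P' x)) x) \<in> W"
      using stable_subspace.left[OF stable_subspace_axioms *(2)]
      by (simp add: commutator_op_def linear_diff[OF linear])
    thus ?case using orbit_span.left[OF *(1)] by blast
  next
    case (right P)
    then obtain P' where *: "P' \<in> ?M" "(\<lambda>x. P x - ?U P' x) \<in> W" by blast
    have "(\<lambda>x. P (a x) - ?U (\<lambda>x. P' (a x)) x) \<in> W"
      using stable_subspace.right[OF stable_subspace_axioms *(2)] by (simp add: commutator_op_def)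
    thus ?case using orbit_span.right[OF *(1)] by blast
  qed
  \<comment> \<open>Errors in \<open>W\<close> stay in \<open>W\<close> under \<open>R - L\<close>
    (fact \<open>U_W\<close>), so the congruence can be iterated.\<close>
  have iterate: "\<exists>Q\<in>?M. (\<lambda>x. P x - (?U ^^ n) Q x) \<in> W" if "P \<in> ?M" for P n
    using that
  proof (induction n arbitrary: P)
    case 0
    thus ?case using zero by (intro bexI[of _ P]) auto
  next
    case (Suc n)
    obtain Q where Q: "Q \<in> ?M" "(\<lambda>x. P x - ?U Q x) \<in> W" using step[OF Suc.prems] by blast
    obtain Q' where Q': "Q' \<in> ?M" "(\<lambda>x. Q x - (?U ^^ n) Q' x) \<in> W" using Suc.IH[OF Q(1)] by blast
    have "(\<lambda>x. P x - (?U ^^ Suc n) Q' x) \<in> W"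
      using add[OF Q(2) U_W[OF Q'(2)]] by (simp add: U_diff)
    thus ?case using Q'(1) by blast
  qed
  have p_div: "\<exists>Q\<in>?M. (\<lambda>x. P x - real p *\<^sub>R Q x) \<in> W" if "P \<in> ?M" for P
    using iterate[OF that, of "p ^ s"] commutator_op_prime_power[OF linear ord p] by fastforce
  define q where "q = p ^ s"
  have q: "q > 0" "a ^^ q = id" using p ord by (auto simp: q_def prime_gt_0_nat)
  define J where "J = I \<times> {..<q} \<times> {..<q}"
  define E where "E = (\<lambda>(i,s,t) x. (a ^^ s) (D i ((a ^^ t) x)))"
  have EM: "E j \<in> ?M" if "j \<in> J" for j
    using that unfolding J_def E_def
    by (clarsimp, intro orbit_span_left_pow orbit_span_right_pow orbit_span.gen)
  have "\<exists>c. (\<lambda>x. E j x - (\<Sum>h\<in>J. (real p * of_int (c h)) *\<^sub>R E h x)) \<in> W" if j: "j \<in> J" for j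
  proof -
    obtain Q where Q: "Q \<in> ?M" "(\<lambda>x. E j x - real p *\<^sub>R Q x) \<in> W" using p_div[OF EM[OF j]] by blast
    obtain c where c: "Q = (\<lambda>x. \<Sum>j\<in>J. of_int (c j) *\<^sub>R E j x)"
      using orbit_span_finite_combination[OF linear I q(2,1) Q(1)]
      unfolding J_def E_def by (auto simp: case_prod_unfold)
    have "(\<lambda>x. E j x - (\<Sum>h\<in>J. (real p * of_int (c h)) *\<^sub>R E h x)) \<in> W"
      using Q(2) unfolding c by (simp add: scaleR_sum_right)
    thus ?thesis by blast
  qed
  hence "\<exists>c. \<forall>j\<in>J. (\<lambda>x. E j x - (\<Sum>h\<in>J. (real p * of_int (c j h)) *\<^sub>R E h x)) \<in> W"
    by (intro bchoice ballI)
  then obtain c where c: "\<And>j. j \<in> J \<Longrightarrow> (\<lambda>x. E j x - (\<Sum>h\<in>J. (real p * of_int (c j h)) *\<^sub>R E h x)) \<in> W"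
    by blast
  \<comment> \<open>Nakayama's lemma is applied to the whole family indexed by \<open>J\<close>, not
    just to the \<open>D i\<close>, since the relations modulo \<open>p\<close> mix all of its
    members.\<close>
  have EW: "\<forall>j\<in>J. E j \<in> W"
    by (rule nakayama[OF _ p p_local_of_int[OF p] c]) (use I in \<open>auto simp: J_def\<close>)
  show ?thesis
  proof
    fix i assume "i \<in> I"
    hence "E (i,0,0) \<in> W" using EW q(1) by (auto simp: J_def)
    thus "D i \<in> W" by (simp add: E_def)
  qed
qed

section \<open>Words in generators with a common linear part\<close>

lemma germ_eq_refl: "germ_eq f f"
  by (simp add: germ_eq_def)

lemma germ_eq_sym: "germ_eq f g \<Longrightarrow> germ_eq g f"
  by (simp add: germ_eq_def eq_commute)

lemma germ_eq_trans [trans]: "germ_eq f g \<Longrightarrow> germ_eq g h \<Longrightarrow> germ_eq f h"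
  unfolding germ_eq_def by (auto elim: eventually_elim2)

lemma germ_eq_comp_left: "germ_eq g g' \<Longrightarrow> germ_eq (f \<circ> g) (f \<circ> g')"
  unfolding germ_eq_def by (erule eventually_mono) simp

lemma germ_eq_comp_right:
  "germ_eq f f' \<Longrightarrow> filterlim g (nhds 0) (nhds 0) \<Longrightarrow> germ_eq (f \<circ> g) (f' \<circ> g)"
  unfolding germ_eq_def o_def by (rule eventually_compose_filterlim)

lemma vanishes_at_0: "vanishes k D \<Longrightarrow> k \<ge> 1 \<Longrightarrow> D 0 = 0"
  unfolding vanishes_def by (auto dest!: eventually_nhds_x_imp_x simp: power_0_left)

lemma vanishes_1_bounded_linear:
  assumes "bounded_linear a"
  shows "vanishes 1 a"
proof -
  have "vanishes 1 (\<lambda>x. x)" unfolding vanishes_def by (rule exI[of _ 1]) simp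
  from vanishes_linear[OF this assms] show ?thesis .
qed

lemma funpow_matrix_vector: "\<exists>B. (\<lambda>v. (A::complex^'n^'n) *v v) ^^ m = (\<lambda>v. B *v v)"
proof (induction m)
  case 0
  show ?case by (rule exI[of _ "mat 1"]) (simp add: fun_eq_iff)
next
  case (Suc m)
  then obtain B where "(\<lambda>v. A *v v) ^^ m = (\<lambda>v. B *v v)" by blast
  thus ?case by (intro exI[of _ "A ** B"]) (simp add: fun_eq_iff matrix_vector_mul_assoc)
qed

text \<open>Same fold as the product relation in \<open>basic_generators\<close>, which thus reads
  \<open>germ_eq (word f [1..<\<nu>+2]) id\<close>. There are no inverse letters; that relation will
  express inverses as words.\<close>

definition word :: "(nat \<Rightarrow> 'n::finite cmap) \<Rightarrow> nat list \<Rightarrow> 'n cmap" where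
  "word f ws = foldr (\<lambda>i g. f i \<circ> g) ws id"

lemma word_Nil [simp]: "word f [] = id"
  and word_Cons [simp]: "word f (i # ws) = f i \<circ> word f ws"
  by (simp_all add: word_def)

lemma word_append: "word f (us @ vs) = word f us \<circ> word f vs"
  by (induction us) (simp_all add: o_assoc)

lemma word_replicate: "word f (replicate m i) = f i ^^ m"
  by (induction m) simp_all

text \<open>The index \<open>b\<close> marks the reference generator \<open>F\<close> with which the
  others are compared. A singleton \<open>I\<close> yields facts on the iterates of one
  germ.\<close>

locale tangent_germs =
  fixes f :: "nat \<Rightarrow> 'n::finite cmap" and I :: "nat set" and b :: nat and A :: "complex^'n^'n"
  assumes finite_index: "finite I" and base: "b \<in> I"
    and fix0: "i \<in> I \<Longrightarrow> f i 0 = 0"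
    and holo: "i \<in> I \<Longrightarrow> holo_near0 (f i)"
    and tangent: "i \<in> I \<Longrightarrow> (f i has_derivative (\<lambda>v. A *v v)) (at 0)"
begin

abbreviation a :: "'n cmap" where "a \<equiv> (\<lambda>v. A *v v)"
abbreviation F :: "'n cmap" where "F \<equiv> f b"
abbreviation D :: "nat \<Rightarrow> 'n cmap" where "D i \<equiv> (\<lambda>x. f i x - F x)"

lemma word_germ:
  assumes "set ws \<subseteq> I"
  shows "word f ws 0 = 0" "holo_near0 (word f ws)" "(word f ws has_derivative (a ^^ length ws)) (at 0)"
proof -
  have "word f ws 0 = 0 \<and> holo_near0 (word f ws) \<and> (word f ws has_derivative (a ^^ length ws)) (at 0)"
    using assms
  proof (induction ws)
    case Nil
    show ?case by (simp add: holo_near0_id[unfolded id_def] id_def)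
  next
    case (Cons i ws)
    have "(f i \<circ> word f ws has_derivative a \<circ> (a ^^ length ws)) (at 0)"
      using Cons tangent[of i] by (intro diff_chain_at) auto
    moreover have "holo_near0 (f i \<circ> word f ws)" using Cons holo[of i] by (intro holo_near0_compose) auto
    ultimately show ?case using Cons fix0[of i]
      by (metis comp_apply funpow.simps(2) length_Cons list.set_intros(1) set_subset_Cons subset_iff word_Cons)
  qed
  thus "word f ws 0 = 0" "holo_near0 (word f ws)" "(word f ws has_derivative (a ^^ length ws)) (at 0)"
    by auto
qed

lemma funpow_germ:
  assumes "i \<in> I"
  shows "(f i ^^ k) 0 = 0" "holo_near0 (f i ^^ k)" "(f i ^^ k has_derivative (a ^^ k)) (at 0)"
proof -
  have "set (replicate k i) \<subseteq> I" using assms by auto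
  from word_germ[OF this, unfolded word_replicate length_replicate]
  show "(f i ^^ k) 0 = 0" "holo_near0 (f i ^^ k)" "(f i ^^ k has_derivative (a ^^ k)) (at 0)" .
qed

lemma word_tendsto: "set ws \<subseteq> I \<Longrightarrow> filterlim (word f ws) (nhds 0) (nhds 0)"
  using word_germ holo_near0_tendsto by blast

lemma vanishes_1_apow: "vanishes 1 (a ^^ m)"
proof -
  obtain B where "a ^^ m = (\<lambda>v. B *v v)" using funpow_matrix_vector by blast
  thus ?thesis using vanishes_1_bounded_linear[OF bounded_linear_matrix_vector] by simp
qed

lemma word_tangent:
  assumes "set ws \<subseteq> I"
  shows "vanishes 2 (\<lambda>x. word f ws x - (a ^^ length ws) x)" "vanishes 1 (word f ws)"
proof -
  obtain B where B: "a ^^ length ws = (\<lambda>v. B *v v)" using funpow_matrix_vector by blast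
  show v2: "vanishes 2 (\<lambda>x. word f ws x - (a ^^ length ws) x)"
  proof (rule vanishes_2I)
    show "holo_near0 (\<lambda>x. word f ws x - (a ^^ length ws) x)"
      unfolding B by (intro holo_near0_diff word_germ assms holo_near0_matrix)
    show "word f ws 0 - (a ^^ length ws) 0 = 0" using word_germ(1)[OF assms] by (simp add: B)
    have "((a ^^ length ws) has_derivative (a ^^ length ws)) (at 0)"
      unfolding B by (rule bounded_linear_imp_has_derivative[OF bounded_linear_matrix_vector])
    from has_derivative_diff[OF word_germ(3)[OF assms] this]
    show "((\<lambda>x. word f ws x - (a ^^ length ws) x) has_derivative (\<lambda>_. 0)) (at 0)" by simp
  qed
  show "vanishes 1 (word f ws)"
    using vanishes_add[OF vanishes_mono[OF v2, of 1] vanishes_1_apow[of "length ws"]] by simp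
qed

lemma orbit_span_germ:
  assumes "k \<ge> 1" and D: "\<And>i. i \<in> I \<Longrightarrow> vanishes k (D i)" and Q: "Q \<in> orbit_span a I D"
  shows "holo_near0 Q" "vanishes k Q"
proof -
  have "holo_near0 Q \<and> vanishes k Q" using Q
  proof (induction rule: orbit_span.induct)
    case zero
    show ?case by (simp add: holo_near0_zero vanishes_zero)
  next
    case (gen i)
    thus ?case using D holo base by (auto intro: holo_near0_diff)
  next
    case (diff P Q)
    thus ?case by (auto intro: holo_near0_diff vanishes_diff)
  next
    case (left Q)
    hence "Q 0 = 0" using vanishes_at_0 assms(1) by blast
    thus ?case using left.IH holo_near0_compose[OF holo_near0_matrix[of A], of Q]
        vanishes_linear[OF _ bounded_linear_matrix_vector, of k Q A] by (simp add: o_def)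
  next
    case (right Q)
    have "vanishes 1 a" using vanishes_1_apow[of 1] by simp
    thus ?case using right.IH holo_near0_compose[OF _ holo_near0_matrix[of A], of Q]
        vanishes_compose[of k Q a] by (simp add: o_def)
  qed
  thus "holo_near0 Q" "vanishes k Q" by auto
qed

text \<open>Split \<open>f i\<close> as \<open>F + D i\<close>. Linearizing the argument of
  \<open>D i\<close> costs order \<open>k + 2 - 1\<close>; the nonlinear part \<open>F - a\<close>
  changes by order \<open>2 + k - 1\<close> between the word and \<open>F ^^ m\<close>; and
  \<open>a\<close> passes through the sum. These three errors are \<open>t1\<close>,
  \<open>t2\<close> and \<open>t3\<close>.\<close>

lemma left_mult_expansion:
  assumes k: "k \<ge> 2" and D: "\<And>i. i \<in> I \<Longrightarrow> vanishes k (D i)"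
    and i: "i \<in> I" and ws: "set ws \<subseteq> I" and Q: "Q \<in> orbit_span a I D"
    and exp: "vanishes (k + 1) (\<lambda>x. word f ws x - (F ^^ length ws) x - Q x)"
  shows "vanishes (k + 1) (\<lambda>x. f i (word f ws x) - (F ^^ Suc (length ws)) x - (a (Q x) + D i ((a ^^ length ws) x)))"
proof -
  let ?m = "length ws" and ?g = "word f ws"
  have k1: "1 \<le> k" using k by simp
  have Fm: "F ^^ ?m = word f (replicate ?m b)" by (simp only: word_replicate)
  have rep: "set (replicate ?m b) \<subseteq> I" using base by auto
  have Fm1: "vanishes 1 (F ^^ ?m)" unfolding Fm using word_tangent[OF rep] by simp
  have "vanishes (k + 2 - 1) (\<lambda>x. D i (?g x) - D i ((a ^^ ?m) x))"
    by (rule vanishes_compose_diff[OF _ D[OF i] k1 word_tangent(2)[OF ws] vanishes_1_apow word_tangent(1)[OF ws]])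
       (intro holo_near0_diff holo i base)
  hence t1: "vanishes (k + 1) (\<lambda>x. D i (?g x) - D i ((a ^^ ?m) x))" by simp
  have H: "vanishes 2 (\<lambda>x. F x - a x)" using word_tangent(1)[of "[b]"] base by simp
  have gF: "vanishes k (\<lambda>x. ?g x - (F ^^ ?m) x)"
    using vanishes_add[OF vanishes_mono[OF exp, of k] orbit_span_germ(2)[OF k1 D Q]] by simp
  have "vanishes (2 + k - 1) (\<lambda>x. (F (?g x) - a (?g x)) - (F ((F ^^ ?m) x) - a ((F ^^ ?m) x)))"
    by (rule vanishes_compose_diff[OF _ H _ word_tangent(2)[OF ws] Fm1 gF])
       (auto intro!: holo_near0_diff holo_near0_matrix holo base)
  hence t2: "vanishes (k + 1) (\<lambda>x. (F (?g x) - a (?g x)) - (F ((F ^^ ?m) x) - a ((F ^^ ?m) x)))"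
    by simp
  have t3: "vanishes (k + 1) (\<lambda>x. a (?g x - (F ^^ ?m) x - Q x))"
    by (rule vanishes_linear[OF exp bounded_linear_matrix_vector])
  from vanishes_add[OF vanishes_add[OF t1 t2] t3] show ?thesis
    by (simp add: matrix_vector_mult_diff_distrib algebra_simps)
qed

text \<open>Prepending a letter turns \<open>Q\<close> into
  \<open>a \<circ> Q + D i \<circ> a ^^ m\<close>, which stays in the group.\<close>

lemma word_expansion:
  assumes "k \<ge> 2" "\<And>i. i \<in> I \<Longrightarrow> vanishes k (D i)" "set ws \<subseteq> I"
  shows "\<exists>Q\<in>orbit_span a I D. vanishes (k + 1) (\<lambda>x. word f ws x - (F ^^ length ws) x - Q x)"
  using assms(3)
proof (induction ws)
  case Nil
  show ?case by (rule bexI[OF _ orbit_span.zero]) (simp add: vanishes_zero)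
next
  case (Cons i ws)
  then obtain Q where Q: "Q \<in> orbit_span a I D"
      "vanishes (k + 1) (\<lambda>x. word f ws x - (F ^^ length ws) x - Q x)" by auto
  have i: "i \<in> I" and ws: "set ws \<subseteq> I" using Cons.prems by auto
  have "(\<lambda>x. a (Q x) + D i ((a ^^ length ws) x)) \<in> orbit_span a I D"
    by (rule orbit_span_add[OF orbit_span.left[OF Q(1)] orbit_span_right_pow[OF orbit_span.gen[OF i]]])
  moreover have "vanishes (k + 1) (\<lambda>x. f i (word f ws x) - (F ^^ Suc (length ws)) x - (a (Q x) + D i ((a ^^ length ws) x)))"
    by (rule left_mult_expansion[OF assms(1,2) i ws Q])
  ultimately show ?case by (intro bexI) simp_all
qed

text \<open>Comparing both sides of \<open>f i \<circ> h = h \<circ> F\<close> to order \<open>k\<close>, with \<open>h = F ^^ m + Q\<close>, gives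
  \<open>D i \<circ> a ^^ m = Q \<circ> a - a \<circ> Q\<close>.\<close>

lemma contact_order_step:
  assumes k: "k \<ge> 2" and D: "\<And>i. i \<in> I \<Longrightarrow> vanishes k (D i)"
    and p: "prime p" and ord: "a ^^ (p ^ s) = id"
    and conj: "\<And>i. i \<in> I \<Longrightarrow> \<exists>ws. set ws \<subseteq> I \<and> germ_eq (f i \<circ> word f ws) (word f ws \<circ> F)"
  shows "\<forall>i\<in>I. vanishes (k + 1) (D i)"
proof -
  interpret W: stable_subspace a "{P. vanishes (k + 1) P}"
  proof (rule stable_subspace.intro)
    show "linear a" using bounded_linear_matrix_vector bounded_linear.linear by blast
    show "(\<lambda>x. P (a x)) \<in> {P. vanishes (k + 1) P}" if "P \<in> {P. vanishes (k + 1) P}" for P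
      using that vanishes_compose[OF _ vanishes_1_apow[of 1]] by simp
  qed (auto intro: vanishes_zero vanishes_add vanishes_scaleR vanishes_linear bounded_linear_matrix_vector)
  have k1: "1 \<le> k" using k by simp
  have "\<exists>Q\<in>orbit_span a I D. vanishes (k + 1) (\<lambda>x. D i x - commutator_op a Q x)" if i: "i \<in> I" for i
  proof -
    obtain ws where ws: "set ws \<subseteq> I" "germ_eq (f i \<circ> word f ws) (word f ws \<circ> F)" using conj[OF i] by blast
    let ?m = "length ws" and ?g = "word f ws"
    obtain Q where Q: "Q \<in> orbit_span a I D" "vanishes (k + 1) (\<lambda>x. ?g x - (F ^^ ?m) x - Q x)"
      using word_expansion[OF k D ws(1)] by blast
    have F1: "set [b] \<subseteq> I" using base by simp
    have F: "vanishes 1 F" "vanishes 2 (\<lambda>x. F x - a x)" using word_tangent[OF F1] by auto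
    have l: "vanishes (k + 1) (\<lambda>x. f i (?g x) - (F ^^ Suc ?m) x - (a (Q x) + D i ((a ^^ ?m) x)))"
      by (rule left_mult_expansion[OF k D i ws(1) Q])
    have r1: "vanishes (k + 1) (\<lambda>x. ?g (F x) - (F ^^ Suc ?m) x - Q (F x))"
      using vanishes_compose[OF Q(2) F(1)] by (simp add: funpow_swap1)
    \<comment> \<open>\<open>Q\<close> has order \<open>k\<close> and \<open>F - a\<close> has order
      2, so modulo order \<open>k + 1\<close> the germ \<open>F\<close> inside \<open>Q\<close> may
      be replaced by its linear part.\<close>
    have "vanishes (k + 2 - 1) (\<lambda>x. Q (F x) - Q (a x))"
      by (rule vanishes_compose_diff[OF orbit_span_germ[OF k1 D Q(1)] k1 F(1) _ F(2)])
         (use vanishes_1_apow[of 1] in auto)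
    hence r2: "vanishes (k + 1) (\<lambda>x. Q (F x) - Q (a x))" by simp
    have z: "vanishes (k + 1) (\<lambda>x. f i (?g x) - ?g (F x))"
      by (rule vanishes_cong[OF _ vanishes_zero])
         (use ws(2) in \<open>auto simp: germ_eq_def elim!: eventually_mono\<close>)
    have d: "vanishes (k + 1) (\<lambda>x. D i ((a ^^ ?m) x) - commutator_op a Q x)"
      using vanishes_add[OF vanishes_add[OF vanishes_diff[OF z l] r1] r2]
      by (simp add: commutator_op_def algebra_simps)
    \<comment> \<open>\<open>?m + n\<close> is a multiple of \<open>p ^ s\<close>, so
      \<open>a ^^ n\<close> inverts \<open>a ^^ ?m\<close>; composing with it on the right strips
      the power of \<open>a\<close> from \<open>D i\<close>.\<close>
    define n where "n = p ^ s * ?m - ?m"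
    have "n + ?m = p ^ s * ?m" using p by (simp add: n_def prime_gt_0_nat Suc_leI)
    hence "?m + n = p ^ s * ?m" by simp
    hence "a ^^ (?m + n) = (a ^^ (p ^ s)) ^^ ?m" by (simp only: funpow_mult)
    hence an: "(a ^^ ?m) ((a ^^ n) x) = x" for x
      using ord by (simp add: funpow_add fun_eq_iff)
    have "vanishes (k + 1) (\<lambda>x. D i x - commutator_op a (\<lambda>x. Q ((a ^^ n) x)) x)"
      using vanishes_compose[OF d vanishes_1_apow[of n]]
      by (simp add: an commutator_op_def funpow_swap1)
    thus ?thesis using orbit_span_right_pow[OF Q(1)] by blast
  qed
  hence "\<forall>i\<in>I. D i \<in> {P. vanishes (k + 1) P}"
    by (intro W.orbit_span_collapse[OF p ord finite_index]) simp
  thus ?thesis by simp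
qed

lemma generators_germ_eq:
  assumes p: "prime p" and ord: "a ^^ (p ^ s) = id"
    and conj: "\<And>i. i \<in> I \<Longrightarrow> \<exists>ws. set ws \<subseteq> I \<and> germ_eq (f i \<circ> word f ws) (word f ws \<circ> F)"
    and i: "i \<in> I"
  shows "germ_eq (f i) F"
proof -
  \<comment> \<open>The induction starts at order 2, provided by the common linear part; contact of
    infinite order then means equality of germs.\<close>
  have "\<forall>i\<in>I. vanishes (k + 2) (D i)" for k
  proof (induction k)
    case 0
    have "vanishes 2 (D i)" if "i \<in> I" for i
      using vanishes_diff[OF word_tangent(1)[of "[i]"] word_tangent(1)[of "[b]"]] that base by simp
    thus ?case by (simp add: numeral_2_eq_2)
  next
    case (Suc k)
    from contact_order_step[OF _ _ p ord conj, of "k + 2"] Suc show ?case by simp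
  qed
  hence "vanishes k (D i)" for k using i vanishes_mono[of "k + 2" "D i" k] by auto
  hence "\<forall>\<^sub>F x in nhds 0. D i x = 0"
    using holo i base by (intro flat_imp_germ_zero holo_near0_diff)
  thus ?thesis by (simp add: germ_eq_def)
qed

end

section \<open>Inverses of generators as words\<close>

lemma word_left_inverse:
  assumes "\<forall>i\<in>I. diff_germ (f i)" "set ws \<subseteq> I"
  shows "word f ws 0 = 0 \<and> holo_near0 (word f ws) \<and> (\<exists>k. germ_eq (k \<circ> word f ws) id)"
  using assms(2)
proof (induction ws)
  case Nil
  have "germ_eq (id \<circ> word f []) id" by (simp add: germ_eq_refl)
  thus ?case using holo_near0_id by (metis id_apply word_Nil)
next
  case (Cons i ws)
  then obtain k where k: "germ_eq (k \<circ> word f ws) id" by (meson set_subset_Cons subset_trans)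
  have w: "word f ws 0 = 0" "holo_near0 (word f ws)" using Cons by auto
  have fi: "f i 0 = 0" "holo_near0 (f i)" using assms(1) Cons.prems by (auto simp: diff_germ_def)
  obtain h where "germ_inverse h (f i)" using assms(1) Cons.prems by (auto simp: diff_germ_def)
  hence "germ_eq (h \<circ> f i) id" by (simp add: germ_inverse_def germ_eq_def)
  from germ_eq_comp_right[OF this holo_near0_tendsto[OF w(2,1)]]
  have "germ_eq (k \<circ> (h \<circ> f i \<circ> word f ws)) (k \<circ> word f ws)"
    using germ_eq_comp_left by fastforce
  from germ_eq_trans[OF this k] have "germ_eq ((k \<circ> h) \<circ> word f (i # ws)) id"
    by (simp add: o_assoc)
  moreover have "holo_near0 (word f (i # ws))" using holo_near0_compose[OF fi(2) w(2,1)] by simp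
  ultimately show ?case using w fi by (metis comp_apply word_Cons)
qed

text \<open>If the full word splits as \<open>us @ i # vs\<close>, the product relation can be
  rotated so that \<open>f i\<close> comes first, and the inverse of \<open>f i\<close> is then the
  word \<open>vs @ us\<close>.\<close>

lemma basic_generators_word:
  assumes G: "basic_generators G f \<nu>" and g: "g \<in> G"
  shows "\<exists>ws. set ws \<subseteq> {1..\<nu>+1} \<and> germ_eq g (word f ws)"
proof -
  let ?I = "{1..\<nu>+1}"
  have diff: "\<forall>i\<in>?I. diff_germ (f i)" and G_eq: "G = gen_group (f ` ?I)"
    and prod: "germ_eq (word f [1..<\<nu>+2]) id"
    using G by (auto simp: basic_generators_def word_def)
  have inv: "\<exists>ws. set ws \<subseteq> ?I \<and> germ_eq h (word f ws)" if i: "i \<in> ?I" and h: "germ_inverse h (f i)" for i h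
  proof -
    obtain us vs where split: "[1..<\<nu>+2] = us @ i # vs" using i by (metis split_list atLeastLessThan_iff
        atLeastAtMost_iff set_upt Suc_eq_plus1 add_2_eq_Suc' less_Suc_eq_le)
    have sub: "set us \<subseteq> ?I" "set vs \<subseteq> ?I"
    proof -
      have "set [1..<\<nu>+2] = ?I" by auto
      thus "set us \<subseteq> ?I" "set vs \<subseteq> ?I" unfolding split by auto
    qed
    let ?a = "word f us" and ?b = "word f vs"
    note w = word_left_inverse[OF diff]
    obtain k where k: "germ_eq (k \<circ> ?a) id" using w[OF sub(1)] by blast
    have ibv: "set (i # vs) \<subseteq> ?I" using sub i by auto
    have "germ_eq (k \<circ> ?a \<circ> word f (i # vs)) (id \<circ> word f (i # vs))"
      using w[OF ibv] by (intro germ_eq_comp_right[OF k] holo_near0_tendsto) auto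
    hence "germ_eq (word f (i # vs)) (k \<circ> (?a \<circ> word f (i # vs)))"
      by (simp add: germ_eq_sym o_assoc)
    also have "germ_eq (k \<circ> (?a \<circ> word f (i # vs))) (k \<circ> id)"
      using prod unfolding split word_append by (rule germ_eq_comp_left)
    \<comment> \<open>A left and a right inverse of \<open>?a\<close> agree as germs, so the two
      factors of the product relation may be swapped.\<close>
    finally have "germ_eq (word f (i # vs)) k" by simp
    hence "germ_eq (word f (i # vs) \<circ> ?a) (k \<circ> ?a)"
      using w[OF sub(1)] by (intro germ_eq_comp_right holo_near0_tendsto) auto
    from germ_eq_trans[OF this k] have fba: "germ_eq (f i \<circ> (?b \<circ> ?a)) id" by (simp add: o_assoc)
    have ba: "set (vs @ us) \<subseteq> ?I" using sub by auto
    have "germ_eq (h \<circ> f i) id" using h by (simp add: germ_inverse_def germ_eq_def)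
    hence "germ_eq (h \<circ> f i \<circ> word f (vs @ us)) (id \<circ> word f (vs @ us))"
      using w[OF ba] by (intro germ_eq_comp_right holo_near0_tendsto) auto
    hence "germ_eq (word f (vs @ us)) (h \<circ> (f i \<circ> (?b \<circ> ?a)))"
      by (simp add: germ_eq_sym o_assoc word_append)
    also have "germ_eq (h \<circ> (f i \<circ> (?b \<circ> ?a))) (h \<circ> id)" using fba by (rule germ_eq_comp_left)
    finally have "germ_eq h (word f (vs @ us))" by (simp add: germ_eq_sym)
    thus ?thesis using ba by blast
  qed
  from g[unfolded G_eq] show ?thesis
  proof (induction rule: gen_group.induct)
    case gen_id
    show ?case by (intro exI[of _ "[]"]) (simp add: germ_eq_refl)
  next
    case (gen_mult g f')
    then obtain ws i where "set ws \<subseteq> ?I" "germ_eq g (word f ws)" "f' = f i" "i \<in> ?I" by blast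
    moreover from this have "germ_eq (f' \<circ> g) (word f (i # ws))"
      unfolding word_Cons by (simp only: germ_eq_comp_left)
    moreover have "set (i # ws) \<subseteq> ?I" using calculation by simp
    ultimately show ?case by blast
  next
    case (gen_inv g f' h)
    then obtain ws i where ws: "set ws \<subseteq> ?I" "germ_eq g (word f ws)" "f' = f i" "i \<in> ?I" by blast
    obtain us where us: "set us \<subseteq> ?I" "germ_eq h (word f us)" using inv gen_inv ws by blast
    have "germ_eq (h \<circ> g) (h \<circ> word f ws)" using ws(2) by (rule germ_eq_comp_left)
    also have "germ_eq (h \<circ> word f ws) (word f us \<circ> word f ws)"
      using word_left_inverse[OF diff ws(1)] by (intro germ_eq_comp_right[OF us(2)] holo_near0_tendsto) auto
    finally have "germ_eq (h \<circ> g) (word f (us @ ws))" unfolding word_append .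
    moreover have "set (us @ ws) \<subseteq> ?I" using ws us by simp
    ultimately show ?case by blast
  next
    case (gen_germ g g')
    thus ?case using germ_eq_trans germ_eq_sym by blast
  qed
qed

section \<open>Diagonalization and linearization\<close>

lemma matrix_vector_mult_sum: "(A::complex^'n^'m) *v (\<Sum>i\<in>S. g i) = (\<Sum>i\<in>S. A *v g i)"
  by (rule linear_sum[OF bounded_linear.linear[OF bounded_linear_matrix_vector]])

lemma sum_root_unity_powers:
  fixes w :: complex
  assumes "w ^ N = 1" "w \<noteq> 1"
  shows "(\<Sum>k<N. w ^ k) = 0"
  using assms by (simp add: sum_gp_strict)

text \<open>Discrete Fourier decomposition: with \<open>w\<close> a primitive \<open>N\<close>th
  root of unity, \<open>u k\<close> is zero or an eigenvector for the inverse of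
  \<open>w ^ k\<close>. By orthogonality of characters, \<open>v\<close> is the average of the
  \<open>u k\<close>.\<close>

lemma finite_order_eigenvectors_span:
  fixes A :: "complex^'n^'n"
  assumes N: "N > 0" and ord: "((*v) A) ^^ N = id"
  shows "vec.span {v. \<exists>l. A *v v = l *s v} = UNIV"
proof -
  let ?a = "(*v) A" and ?E = "{v. \<exists>l. A *v v = l *s v}"
  define w :: complex where "w = exp (2 * of_real pi * \<i> / of_nat N)"
  have wj: "w ^ j = exp (2 * of_real pi * \<i> * of_nat j / of_nat N)" for j
    unfolding w_def exp_of_nat_mult[symmetric] by (simp add: mult_ac)
  have w1: "w ^ j = 1 \<longleftrightarrow> N dvd j" for j
    unfolding wj using N complex_root_unity_eq_1[of N j] by simp
  have w0: "w \<noteq> 0" by (simp add: w_def)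
  have "v \<in> vec.span ?E" for v
  proof -
    define u where "u k = (\<Sum>j<N. (w ^ k) ^ j *s (?a ^^ j) v)" for k
    have eig: "A *v u k = inverse (w ^ k) *s u k" for k
    proof -
      let ?t = "\<lambda>j. (w ^ k) ^ j *s (?a ^^ j) v"
      have tN: "?t N = ?t 0" using ord w1[of "N * k"] by (simp add: power_mult[symmetric] mult.commute)
      have "w ^ k *s (A *v u k) = (\<Sum>j<N. ?t (Suc j))"
        by (simp add: u_def matrix_vector_mult_sum vec.scale_sum_right vector_scalar_commute)
      also have "\<dots> = u k"
        using sum.lessThan_Suc_shift[of ?t N] sum.lessThan_Suc[of ?t N] tN by (simp add: u_def)
      finally have "inverse (w ^ k) *s (w ^ k *s (A *v u k)) = inverse (w ^ k) *s u k" by simp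
      thus ?thesis using w0 by (simp add: vector_smult_assoc)
    qed
    have "(\<Sum>k<N. u k) = (\<Sum>j<N. (\<Sum>k<N. (w ^ j) ^ k) *s (?a ^^ j) v)"
      unfolding u_def vec.scale_sum_left
      by (subst sum.swap) (simp add: power_mult[symmetric] mult.commute)
    also have "\<dots> = (\<Sum>j<N. if j = 0 then of_nat N *s v else 0)"
    proof (rule sum.cong[OF refl])
      fix j assume j: "j \<in> {..<N}"
      have "(\<Sum>k<N. (w ^ j) ^ k) = 0" if "j \<noteq> 0"
        using w1[of j] w1[of "j * N"] j that nat_dvd_not_less[of j N]
        by (intro sum_root_unity_powers) (auto simp: power_mult[symmetric])
      thus "(\<Sum>k<N. (w ^ j) ^ k) *s (?a ^^ j) v = (if j = 0 then of_nat N *s v else 0)" by simp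
    qed
    also have "\<dots> = of_nat N *s v" using N by simp
    finally have v: "v = inverse (of_nat N) *s (\<Sum>k<N. u k)" using N by (simp add: vector_smult_assoc)
    have "(\<Sum>k<N. u k) \<in> vec.span ?E"
      using eig by (intro vec.span_sum vec.span_base) blast
    thus ?thesis by (subst v) (rule vec.span_scale)
  qed
  thus ?thesis by blast
qed

text \<open>A basis can be selected from the spanning set of eigenvectors; its members become the
  columns of \<open>P\<close>.\<close>

lemma finite_order_diagonalizable:
  fixes A :: "complex^'n^'n"
  assumes "N > 0" "((*v) A) ^^ N = id"
  shows "\<exists>(P::complex^'n^'n) P' \<xi>. P ** P' = mat 1 \<and> P' ** P = mat 1 \<and> (\<forall>x. A *v (P *v x) = P *v (diag_map \<xi> x)) \<and>
    (\<forall>j. is_eigenvalue A (\<xi> j))"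
proof -
  let ?E = "{v. \<exists>l. A *v v = l *s v}"
  obtain B where B: "B \<subseteq> ?E" "vec.independent B" "?E \<subseteq> vec.span B"
    using vec.maximal_independent_subset by blast
  have span: "vec.span B = UNIV"
    using finite_order_eigenvectors_span[OF assms] vec.span_minimal[OF B(3) vec.subspace_span] by blast
  have "card B = CARD('n)"
    using vec.dim_eq_card[of B UNIV] span B(2) vec.dim_UNIV vec.dimension_def card_cart_basis
    by (metis vec.span_UNIV)
  moreover have "finite B" using B(2) by (rule vec.finiteI_independent)
  ultimately obtain b :: "'n \<Rightarrow> complex^'n" where b: "bij_betw b UNIV B"
    using finite_same_card_bij[of "UNIV :: 'n set" B] by auto
  hence bB: "b j \<in> B" for j by (auto simp: bij_betw_def)
  hence "\<exists>l. A *v b j = l *s b j" for j using B(1) by blast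
  then obtain \<xi> where \<xi>: "\<And>j. A *v b j = \<xi> j *s b j" by metis
  define P :: "complex^'n^'n" where "P = (\<chi> r c. b c $ r)"
  have col: "column c P = b c" for c by (simp add: column_def P_def vec_eq_iff)
  hence "columns P = B" using b by (auto simp: columns_def bij_betw_def)
  then obtain P' where P': "P ** P' = mat 1" using span matrix_right_invertible_span_columns by metis
  have Pv: "P *v x = (\<Sum>i\<in>UNIV. x $ i *s b i)" for x by (simp add: matrix_mult_sum col)
  have "A *v (P *v x) = P *v (diag_map \<xi> x)" for x
    unfolding Pv matrix_vector_mult_sum
    by (simp add: vector_scalar_commute \<xi> diag_map_def vector_smult_assoc mult.commute)
  moreover have "is_eigenvalue A (\<xi> j)" for j
  proof -
    have "b j \<noteq> 0" using bB[of j] B(2) vec.dependent_zero by metis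
    thus ?thesis using \<xi> unfolding is_eigenvalue_def by blast
  qed
  moreover have "P' ** P = mat 1" using P' matrix_left_right_inverse by blast
  ultimately show ?thesis using P' by blast
qed

lemma diag_map_funpow: "(diag_map \<xi> ^^ m) x = (\<chi> j. \<xi> j ^ m * x $ j)"
  by (induction m) (simp_all add: diag_map_def vec_eq_iff mult.assoc)

text \<open>Finite order rules out Jordan blocks, so the eigenvalues alone decide which powers of
  \<open>A\<close> are the identity. The sum of their exponents serves as a common exponent.\<close>

lemma prime_power_order:
  fixes A :: "complex^'n^'n"
  assumes "N > 0" "((*v) A) ^^ N = id"
    and "\<forall>l. is_eigenvalue A l \<longrightarrow> (\<exists>s::nat. root_of_unity_order l (p ^ s))"
  shows "\<exists>s. ((*v) A) ^^ (p ^ s) = id"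
proof -
  obtain P P' :: "complex^'n^'n" and \<xi> where P: "P ** P' = mat 1" "P' ** P = mat 1"
      "\<And>x. A *v (P *v x) = P *v (diag_map \<xi> x)" "\<And>j. is_eigenvalue A (\<xi> j)"
    using finite_order_diagonalizable[OF assms(1,2)] by blast
  have "\<exists>s. \<xi> j ^ (p ^ s) = 1" for j
    using assms(3) P(4)[of j] unfolding root_of_unity_order_def by blast
  then obtain s where s: "\<And>j. \<xi> j ^ (p ^ s j) = 1" by metis
  define S where "S = (\<Sum>j\<in>UNIV. s j)"
  have S: "\<xi> j ^ (p ^ S) = 1" for j
  proof -
    have "s j \<le> S" unfolding S_def by (rule member_le_sum) auto
    hence "p ^ S = p ^ s j * p ^ (S - s j)" by (simp add: power_add[symmetric])
    thus ?thesis using s[of j] by (simp add: power_mult)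
  qed
  have pow: "((*v) A ^^ m) (P *v x) = P *v ((diag_map \<xi> ^^ m) x)" for m x
    by (induction m) (auto simp: P(3))
  have "((*v) A ^^ (p ^ S)) y = y" for y
  proof -
    have "y = P *v (P' *v y)" using P(1) by (simp add: matrix_vector_mul_assoc)
    moreover have "(diag_map \<xi> ^^ (p ^ S)) x = x" for x by (simp add: diag_map_funpow S)
    ultimately show ?thesis using pow by metis
  qed
  thus ?thesis by (auto simp: fun_eq_iff)
qed

text \<open>\<open>\<Lambda>\<close> differs from the identity by a map of order 2, which has
  Lipschitz constant 1/2 on a small ball: this gives injectivity and invertible derivatives there.
  The last clause ranges over all \<open>y\<close>, near 0 or not, and so constrains the
  representative \<open>\<phi>\<close> rather than its germ.\<close>

lemma holo_local_inverse:
  fixes \<Lambda> :: "'n::finite cmap"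
  assumes holo: "holo_near0 \<Lambda>" and "\<Lambda> 0 = 0" and der: "(\<Lambda> has_derivative (\<lambda>v. v)) (at 0)"
  shows "\<exists>\<phi> \<psi>. germ_eq \<phi> \<Lambda> \<and> germ_inverse \<psi> \<phi> \<and> (\<exists>\<delta>>0. \<forall>y. norm (\<phi> y) < \<delta> \<longrightarrow> \<psi> (\<phi> y) = y)"
proof -
  define D where "D x = \<Lambda> x - x" for x
  have D: "holo_near0 D" unfolding D_def
    using holo_near0_diff[OF holo holo_near0_id] by simp
  have "vanishes 2 D"
    using D assms(2) has_derivative_diff[OF der has_derivative_ident]
    by (intro vanishes_2I) (auto simp: D_def[abs_def])
  then obtain C where C: "C > 0" "\<forall>\<^sub>F x in nhds 0. norm (D x) \<le> C * norm x ^ 2"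
    using vanishes_nonneg_bound by blast
  have "\<forall>\<^sub>F x in nhds 0. (\<exists>L. (D has_derivative L) (at x) \<and> complex_homogeneous L) \<and> norm (D x) \<le> C * norm x ^ 2"
    using D C(2) unfolding holo_near0_iff_eventually by (rule eventually_conj)
  then obtain R0 where R0: "R0 > 0" "\<forall>x\<in>ball 0 R0. \<exists>L. (D has_derivative L) (at x) \<and> complex_homogeneous L"
      "\<forall>x\<in>ball 0 R0. norm (D x) \<le> C * norm x ^ 2"
    unfolding eventually_nhds_metric by auto
  \<comment> \<open>The second bound makes the Lipschitz constant
    \<open>4 * CARD('n) * C * R\<close> at most 1/2.\<close>
  define R where "R = min R0 (1 / (8 * CARD('n) * C))"
  have R: "R > 0" "R \<le> R0" "R \<le> 1 / (8 * CARD('n) * C)" using R0(1) C(1) by (auto simp: R_def)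
  have RD: "\<forall>x\<in>ball 0 R. \<exists>L. (D has_derivative L) (at x) \<and> complex_homogeneous L"
    using R0(2) R(2) by auto
  have RB: "\<forall>x\<in>ball 0 R. norm (D x) \<le> C * R\<^sup>2"
  proof
    fix x :: "complex^'n" assume x: "x \<in> ball 0 R"
    have "norm (D x) \<le> C * norm x ^ 2" using R0(3) R(2) x by auto
    also have "\<dots> \<le> C * R\<^sup>2" using C(1) x by (intro mult_left_mono power_mono) auto
    finally show "norm (D x) \<le> C * R\<^sup>2" .
  qed
  have K: "CARD('n) * (4 * (C * R\<^sup>2) / R) \<le> 1/2"
  proof -
    have "CARD('n) * (4 * (C * R\<^sup>2) / R) = 4 * CARD('n) * C * R" using R(1) by (simp add: power2_eq_square)
    also have "\<dots> \<le> 4 * CARD('n) * C * (1 / (8 * CARD('n) * C))"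
      using R(3) C(1) by (intro mult_left_mono) auto
    also have "\<dots> = 1/2" using C(1) by (simp add: field_simps)
    finally show ?thesis .
  qed
  define U :: "(complex^'n) set" where "U = ball 0 (R/2)"
  have U: "open U" "0 \<in> U" "\<And>x. x \<in> U \<Longrightarrow> x \<in> ball 0 R" using R(1) by (auto simp: U_def)
  have inj: "inj_on \<Lambda> U"
  proof (rule inj_onI)
    fix y z assume yz: "y \<in> U" "z \<in> U" "\<Lambda> y = \<Lambda> z"
    have "norm (D y - D z) \<le> CARD('n) * (4 * (C * R\<^sup>2) / R) * norm (y - z)"
      using bounded_holo_lipschitz[OF RD RB] yz by (simp add: U_def)
    also have "\<dots> \<le> 1/2 * norm (y - z)" using K by (rule mult_right_mono) simp
    finally have "norm (y - z) \<le> 1/2 * norm (y - z)" using yz(3) by (simp add: D_def norm_minus_commute)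
    thus "y = z" by simp
  qed
  have \<Lambda>': "\<exists>L g. (\<Lambda> has_derivative L) (at x) \<and> L \<circ> g = id \<and> complex_homogeneous g" if x: "x \<in> U" for x
  proof -
    obtain M where M: "(D has_derivative M) (at x)" "complex_homogeneous M" using RD U(3)[OF x] by blast
    have Mb: "norm (M v) \<le> 1/2 * norm v" for v
      using Cauchy_derivative_bound[OF RD RB _ M, of v] x mult_right_mono[OF K, of "norm v"]
      by (auto simp: U_def intro: order_trans)
    define L where "L v = M v + v" for v
    have "((\<lambda>x. D x + x) has_derivative (\<lambda>v. M v + v)) (at x)"
      by (intro has_derivative_add M has_derivative_ident)
    hence L: "(\<Lambda> has_derivative L) (at x)" by (simp add: D_def[abs_def] L_def[abs_def])
    have Lc: "complex_homogeneous L" using M(2) by (simp add: L_def vector_add_ldistrib)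
    have linL: "linear L" using L has_derivative_bounded_linear bounded_linear.linear by blast
    have injL: "inj L"
    proof (rule linear_injective_0[OF linL, THEN iffD2], intro allI impI)
      fix v assume "L v = 0"
      hence "norm v = norm (M v)" unfolding L_def by (metis add_eq_0_iff norm_minus_cancel)
      thus "v = 0" using Mb[of v] by simp
    qed
    obtain g where g: "\<And>v. L (g v) = v"
      using linear_injective_isomorphism[OF linL injL] by blast
    have "L (g (c *s v)) = L (c *s g v)" for c v using g Lc by simp
    hence "complex_homogeneous g" using injL by (simp add: inj_eq)
    moreover have "L \<circ> g = id" using g by (simp add: fun_eq_iff)
    ultimately show ?thesis using L by blast
  qed
  have cont: "continuous_on U \<Lambda>"
    by (intro continuous_at_imp_continuous_on ballI) (use \<Lambda>' has_derivative_continuous in blast)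
  \<comment> \<open>Openness of the image makes the inverse available on a full neighbourhood of
    0.\<close>
  have opn: "open (\<Lambda> ` U)" by (rule invariance_of_domain[OF cont U(1) inj])
  define \<psi> where "\<psi> = inv_into U \<Lambda>"
  have \<psi>\<Lambda>: "\<psi> (\<Lambda> x) = x" if "x \<in> U" for x using that inj by (simp add: \<psi>_def)
  have nearU: "\<forall>\<^sub>F x in nhds 0. x \<in> U" using U(1,2) by (rule eventually_nhds_in_open)
  have near\<Lambda>U: "\<forall>\<^sub>F y in nhds 0. y \<in> \<Lambda> ` U"
    using opn U(2) assms(2) by (intro eventually_nhds_in_open) (auto intro: rev_image_eqI)
  \<comment> \<open>Away from \<open>U\<close> the representative takes a nonzero constant value: an arbitrary function \<open>g\<close>
    with \<open>\<phi> \<circ> g \<circ> \<psi>\<close> prescribed near 0 must not be able to escape to far-away small values of \<open>\<phi>\<close>.\<close>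
  define w :: "complex^'n" where "w = 1"
  have w: "w \<noteq> 0" by (simp add: w_def)
  define \<phi> where "\<phi> x = (if x \<in> U then \<Lambda> x else w)" for x
  have "germ_eq \<phi> \<Lambda>" unfolding germ_eq_def using nearU by eventually_elim (simp add: \<phi>_def)
  moreover have "germ_inverse \<psi> \<phi>"
    unfolding germ_inverse_def
  proof (intro conjI)
    show "\<psi> 0 = 0" using \<psi>\<Lambda>[OF U(2)] assms(2) by simp
    show "\<forall>\<^sub>F x in nhds 0. \<psi> (\<phi> x) = x" using nearU by eventually_elim (simp add: \<phi>_def \<psi>\<Lambda>)
    show "\<forall>\<^sub>F y in nhds 0. \<phi> (\<psi> y) = y" using near\<Lambda>U by eventually_elim (auto simp: \<phi>_def \<psi>\<Lambda>)
    show "holo_near0 \<psi>" unfolding holo_near0_iff_eventually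
      using near\<Lambda>U
    proof eventually_elim
      case (elim y)
      then obtain x where x: "x \<in> U" "y = \<Lambda> x" by blast
      obtain L g where "(\<Lambda> has_derivative L) (at x)" "L \<circ> g = id" "complex_homogeneous g"
        using \<Lambda>'[OF x(1)] by blast
      thus ?case using has_derivative_inverse_strong[OF U(1) x(1) cont \<psi>\<Lambda>] x(2) by blast
    qed
  qed
  moreover have "\<psi> (\<phi> y) = y" if "norm (\<phi> y) < norm w" for y
    using that by (cases "y \<in> U") (auto simp: \<phi>_def \<psi>\<Lambda>)
  moreover have "norm w > 0" using w by simp
  ultimately show ?thesis by blast
qed

text \<open>The linearization is the average of the maps \<open>t j\<close>, each being
  \<open>F ^^ j\<close> followed by the inverse of \<open>a ^^ j\<close>. Every summand is tangent
  to the identity, and passing from \<open>\<Lambda> \<circ> F\<close> to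
  \<open>a \<circ> \<Lambda>\<close> only shifts \<open>j\<close> cyclically.\<close>

lemma germ_linearization:
  fixes F :: "'n::finite cmap" and A :: "complex^'n^'n"
  assumes F: "holo_near0 F" "F 0 = 0" "(F has_derivative (*v) A) (at 0)"
    and N: "N > 0" and FN: "germ_eq (F ^^ N) id" and AN: "(*v) A ^^ N = id"
  shows "\<exists>\<Lambda>. holo_near0 \<Lambda> \<and> \<Lambda> 0 = 0 \<and> (\<Lambda> has_derivative (\<lambda>v. v)) (at 0) \<and>
    germ_eq (\<Lambda> \<circ> F) ((*v) A \<circ> \<Lambda>)"
proof -
  let ?a = "(*v) A"
  interpret tangent_germs "\<lambda>_. F" "{0}" 0 A using F by unfold_locales auto
  have Fj: "(F ^^ j) 0 = 0" "holo_near0 (F ^^ j)" "(F ^^ j has_derivative ?a ^^ j) (at 0)" for j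
    using funpow_germ[of 0 j] by simp_all
  \<comment> \<open>The exponent \<open>N - j\<close> plays the role of \<open>-j\<close>, since
    \<open>a ^^ N = id\<close>.\<close>
  define t where "t j x = (?a ^^ (N - j)) ((F ^^ j) x)" for j x
  define \<Lambda> where "\<Lambda> x = inverse (of_nat N) *s (\<Sum>j<N. t j x)" for x
  have t: "t j 0 = 0 \<and> holo_near0 (t j) \<and> (t j has_derivative (\<lambda>v. v)) (at 0)" if "j < N" for j
  proof -
    obtain B where B: "?a ^^ (N - j) = (*v) B" using funpow_matrix_vector by blast
    have tj: "t j = (*v) B \<circ> (F ^^ j)" by (simp add: fun_eq_iff t_def B)
    have "(t j has_derivative (*v) B \<circ> (?a ^^ j)) (at 0)" unfolding tj
      by (intro diff_chain_at Fj bounded_linear_imp_has_derivative bounded_linear_matrix_vector)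
    moreover have "(*v) B \<circ> (?a ^^ j) = (\<lambda>v. v)"
      using that AN by (simp add: B[symmetric] funpow_add[symmetric] id_def)
    moreover have "holo_near0 (t j)" unfolding tj by (intro holo_near0_compose holo_near0_matrix Fj)
    ultimately show ?thesis using Fj(1) by (simp add: tj)
  qed
  have sum: "(\<Sum>j<m. t j 0) = 0 \<and> holo_near0 (\<lambda>x. \<Sum>j<m. t j x) \<and>
      ((\<lambda>x. \<Sum>j<m. t j x) has_derivative (\<lambda>v. of_nat m *s v)) (at 0)" if "m \<le> N" for m
    using that
  proof (induction m)
    case 0
    show ?case using holo_near0_zero by simp
  next
    case (Suc m)
    hence IH: "(\<Sum>j<m. t j 0) = 0" "holo_near0 (\<lambda>x. \<Sum>j<m. t j x)"
      "((\<lambda>x. \<Sum>j<m. t j x) has_derivative (\<lambda>v. of_nat m *s v)) (at 0)" by auto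
    have tm: "t m 0 = 0" "holo_near0 (t m)" "(t m has_derivative (\<lambda>v. v)) (at 0)" using t[of m] Suc.prems by auto
    have "((\<lambda>x. (\<Sum>j<m. t j x) + t m x) has_derivative (\<lambda>v. of_nat m *s v + v)) (at 0)"
      by (intro has_derivative_add IH tm)
    moreover have "(\<lambda>v::complex^'n. of_nat m *s v + v) = (\<lambda>v. of_nat (Suc m) *s v)"
      by (simp add: fun_eq_iff vec_eq_iff algebra_simps)
    moreover have "holo_near0 (\<lambda>x. (\<Sum>j<m. t j x) + t m x)" by (intro holo_near0_add IH tm)
    ultimately show ?case using IH(1) tm(1) by simp
  qed
  have "\<Lambda> 0 = 0" using sum[of N] by (simp add: \<Lambda>_def)
  moreover have "holo_near0 \<Lambda>" using sum[of N] unfolding \<Lambda>_def[abs_def] by (intro holo_near0_scale) auto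
  moreover have "(\<Lambda> has_derivative (\<lambda>v. v)) (at 0)"
  proof -
    have "((*v) (mat (inverse (of_nat N))) \<circ> (\<lambda>x. \<Sum>j<N. t j x) has_derivative
        (*v) (mat (inverse (of_nat N))) \<circ> (\<lambda>v. of_nat N *s v)) (at 0)"
      using sum[of N] by (intro diff_chain_at bounded_linear_imp_has_derivative bounded_linear_matrix_vector) auto
    thus ?thesis using N by (simp add: o_def matrix_scalar \<Lambda>_def[abs_def] vector_smult_assoc)
  qed
  moreover have "germ_eq (\<Lambda> \<circ> F) (?a \<circ> \<Lambda>)"
    unfolding germ_eq_def using FN[unfolded germ_eq_def]
  proof eventually_elim
    case (elim x)
    define u where "u j = ?a (t j x)" for j
    have "t j (F x) = u (Suc j)" if "j < N" for j
    proof -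
      have "(?a ^^ (N - j)) y = ?a ((?a ^^ (N - Suc j)) y)" for y
        using that by (metis Suc_diff_Suc comp_apply funpow.simps(2))
      thus ?thesis by (simp add: u_def t_def funpow_swap1)
    qed
    hence "(\<Sum>j<N. t j (F x)) = (\<Sum>j<N. u (Suc j))" by simp
    \<comment> \<open>This closes the cycle: \<open>F ^^ N\<close> fixes the given \<open>x\<close>
      and \<open>a ^^ N\<close> is the identity.\<close>
    also have "u N = u 0" using elim AN by (simp add: u_def t_def)
    hence "(\<Sum>j<N. u (Suc j)) = (\<Sum>j<N. u j)"
      using sum.lessThan_Suc_shift[of u N] sum.lessThan_Suc[of u N] by simp
    finally show ?case by (simp add: \<Lambda>_def u_def matrix_vector_mult_sum vector_scalar_commute)
  qed
  ultimately show ?thesis by blast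
qed

section \<open>Cyclicity of the group and conjugation to the diagonal model\<close>

theorem theorem1p1:
  fixes G :: "('n::finite) cmap set" and f :: "nat \<Rightarrow> 'n cmap" and \<nu> :: nat
    and A :: "complex^'n^'n" and p :: nat
  assumes "irreducible_group G"
    and "basic_generators G f \<nu>"
    and "\<forall>j\<in>{1..\<nu>+1}. (f j has_derivative (\<lambda>v. A *v v)) (at 0)"
    and "prime p"
    and "\<forall>l. is_eigenvalue A l \<longrightarrow> (\<exists>s::nat. root_of_unity_order l (p ^ s))"
  shows "\<exists>\<phi> \<psi> (\<xi> :: 'n \<Rightarrow> complex).
           diff_germ \<phi> \<and> diff_germ \<psi> \<and> germ_inverse \<psi> \<phi> \<and>
           (\<forall>j. \<exists>r::nat. root_of_unity_order (\<xi> j) (p ^ r)) \<and>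
           (\<forall>g. g \<in> G \<longleftrightarrow> (\<exists>k::nat. germ_eq (\<phi> \<circ> g \<circ> \<psi>) (diag_map \<xi> ^^ k)))"
proof -
  let ?I = "{1..\<nu>+1}" and ?N = "\<nu>+1"
  have diff: "\<forall>i\<in>?I. diff_germ (f i)" and G_eq: "G = gen_group (f ` ?I)"
    and prod: "germ_eq (word f [1..<\<nu>+2]) id"
    and conj_G: "\<forall>i\<in>?I. \<forall>j\<in>?I. \<exists>h\<in>G. germ_eq (f i \<circ> h) (h \<circ> f j)"
    using assms(2) by (auto simp: basic_generators_def word_def)
  define b :: nat where "b = 1"
  interpret tangent_germs f ?I b A
    using diff assms(3) by unfold_locales (auto simp: diff_germ_def b_def)
  let ?F = "f b"
  have len: "length [1..<\<nu>+2] = ?N" unfolding length_upt by simp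
  have all: "set [1..<\<nu>+2] \<subseteq> ?I" by auto
  have F: "?F 0 = 0" "holo_near0 ?F" "(?F has_derivative a) (at 0)"
    using fix0[OF base] holo[OF base] tangent[OF base] .
  have Fk: "(?F ^^ k) 0 = 0" "holo_near0 (?F ^^ k)" for k
    using funpow_germ[OF base, of k] by simp_all

  \<comment> \<open>The chain rule turns the product relation into a statement on the linear part,
    by uniqueness of the derivative at 0.\<close>
  have AN: "a ^^ ?N = id"
  proof -
    have "(word f [1..<\<nu>+2] has_derivative a ^^ ?N) (at 0)" using word_germ(3)[OF all] unfolding len .
    moreover have "(word f [1..<\<nu>+2] has_derivative id) (at 0)"
    proof (rule has_derivative_transform_eventually)
      show "(id has_derivative id) (at 0)" using has_derivative_ident by (simp add: id_def)
      show "\<forall>\<^sub>F x in at 0. id x = word f [1..<\<nu>+2] x"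
        using prod unfolding germ_eq_def eventually_at_filter by (auto elim: eventually_mono)
    qed (use word_germ(1)[OF all] in auto)
    ultimately show ?thesis by (rule has_derivative_unique)
  qed
  obtain s where ord: "a ^^ (p ^ s) = id"
    using prime_power_order[OF _ AN assms(5)] by auto

  have conj: "\<exists>ws. set ws \<subseteq> ?I \<and> germ_eq (f i \<circ> word f ws) (word f ws \<circ> ?F)" if i: "i \<in> ?I" for i
  proof -
    obtain h where h: "h \<in> G" "germ_eq (f i \<circ> h) (h \<circ> ?F)" using conj_G i base by blast
    obtain ws where ws: "set ws \<subseteq> ?I" "germ_eq h (word f ws)"
      using basic_generators_word[OF assms(2) h(1)] by blast
    have "germ_eq (f i \<circ> word f ws) (f i \<circ> h)" using germ_eq_sym[OF ws(2)] by (rule germ_eq_comp_left)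
    also note h(2)
    also have "germ_eq (h \<circ> ?F) (word f ws \<circ> ?F)"
      by (rule germ_eq_comp_right[OF ws(2) holo_near0_tendsto[OF F(2,1)]])
    finally show ?thesis using ws(1) by blast
  qed
  have fi: "germ_eq (f i) ?F" if "i \<in> ?I" for i
    by (rule generators_germ_eq[OF assms(4) ord conj that])
  have word_F: "germ_eq (word f ws) (?F ^^ length ws)" if "set ws \<subseteq> ?I" for ws
    using that
  proof (induction ws)
    case Nil
    show ?case by (simp add: germ_eq_refl)
  next
    case (Cons i ws)
    have "germ_eq (f i \<circ> word f ws) (?F \<circ> word f ws)"
      using Cons.prems fi by (intro germ_eq_comp_right word_tendsto) auto
    also have "germ_eq (?F \<circ> word f ws) (?F \<circ> (?F ^^ length ws))"
      using Cons by (intro germ_eq_comp_left) auto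
    finally show ?case unfolding word_Cons length_Cons funpow.simps .
  qed
  have FN: "germ_eq (?F ^^ ?N) id"
    using germ_eq_trans[OF germ_eq_sym[OF word_F[OF all]] prod] unfolding len .
  \<comment> \<open>Natural exponents are enough because \<open>basic_generators_word\<close> has
    already turned inverses into words.\<close>
  have G_iff: "g \<in> G \<longleftrightarrow> (\<exists>k. germ_eq g (?F ^^ k))" for g
  proof
    assume "g \<in> G"
    then obtain ws where ws: "set ws \<subseteq> ?I" "germ_eq g (word f ws)"
      using basic_generators_word[OF assms(2)] by blast
    from germ_eq_trans[OF ws(2) word_F[OF ws(1)]] show "\<exists>k. germ_eq g (?F ^^ k)" by blast
  next
    assume "\<exists>k. germ_eq g (?F ^^ k)"
    then obtain k where k: "germ_eq g (?F ^^ k)" by blast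
    have "?F ^^ k \<in> G" for k
    proof (induction k)
      case 0
      show ?case unfolding G_eq funpow.simps by (rule gen_group.gen_id)
    next
      case (Suc k)
      thus ?case unfolding G_eq funpow.simps using base by (intro gen_group.gen_mult) auto
    qed
    thus "g \<in> G" using germ_eq_sym[OF k] unfolding G_eq by (rule gen_group.gen_germ)
  qed

  obtain \<Lambda> where \<Lambda>: "holo_near0 \<Lambda>" "\<Lambda> 0 = 0" "(\<Lambda> has_derivative (\<lambda>v. v)) (at 0)"
      "germ_eq (\<Lambda> \<circ> ?F) (a \<circ> \<Lambda>)"
    using germ_linearization[OF F(2,1,3) _ FN AN] by auto
  obtain \<phi> \<psi> \<delta> where \<phi>: "germ_eq \<phi> \<Lambda>" "germ_inverse \<psi> \<phi>" "\<delta> > 0" "\<And>y. norm (\<phi> y) < \<delta> \<Longrightarrow> \<psi> (\<phi> y) = y"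
    using holo_local_inverse[OF \<Lambda>(1-3)] by blast
  obtain P P' :: "complex^'n^'n" and \<xi> where P: "P ** P' = mat 1" "P' ** P = mat 1"
      "\<And>x. A *v (P *v x) = P *v (diag_map \<xi> x)" "\<And>j. is_eigenvalue A (\<xi> j)"
    using finite_order_diagonalizable[OF _ AN] by auto
  have PP': "P *v (P' *v x) = x" "P' *v (P *v x) = x" for x
    using P(1,2) by (simp_all add: matrix_vector_mul_assoc)
  \<comment> \<open>\<open>\<phi>\<close> linearizes \<open>?F\<close>; following it by
    \<open>P'\<close> passes to eigenvector coordinates, in which \<open>a\<close> becomes
    \<open>diag_map \<xi>\<close>.\<close>
  define \<phi>' where "\<phi>' = (*v) P' \<circ> \<phi>"
  define \<psi>' where "\<psi>' = \<psi> \<circ> (*v) P"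
  have \<psi>: "\<psi> 0 = 0" "holo_near0 \<psi>" and \<psi>\<phi>: "germ_eq (\<psi> \<circ> \<phi>) id" and \<phi>\<psi>: "germ_eq (\<phi> \<circ> \<psi>) id"
    using \<phi>(2) by (auto simp: germ_inverse_def germ_eq_def)
  have \<phi>0: "\<phi> 0 = 0" using eventually_nhds_x_imp_x[OF \<phi>(1)[unfolded germ_eq_def]] \<Lambda>(2) by simp
  have \<phi>_holo: "holo_near0 \<phi>" using holo_near0_cong[OF germ_eq_sym[OF \<phi>(1)] \<Lambda>(1)] .
  have lin: "\<phi>' 0 = 0" "holo_near0 \<phi>'" "\<psi>' 0 = 0" "holo_near0 \<psi>'"
    unfolding \<phi>'_def \<psi>'_def
    using \<phi>0 \<psi>(1) holo_near0_compose[OF holo_near0_matrix[of P'] \<phi>_holo \<phi>0]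
      holo_near0_compose[OF \<psi>(2) holo_near0_matrix[of P]] by simp_all
  have limP: "filterlim ((*v) P) (nhds 0) (nhds 0)"
    using holo_near0_tendsto[OF holo_near0_matrix[of P]] by simp
  have inv1: "germ_eq (\<psi>' \<circ> \<phi>') id"
    using \<psi>\<phi> by (simp add: germ_eq_def \<phi>'_def \<psi>'_def PP')
  have inv2: "germ_eq (\<phi>' \<circ> \<psi>') id"
  proof -
    have "germ_eq ((\<phi> \<circ> \<psi>) \<circ> (*v) P) (id \<circ> (*v) P)" by (rule germ_eq_comp_right[OF \<phi>\<psi> limP])
    thus ?thesis unfolding germ_eq_def by eventually_elim (simp add: \<phi>'_def \<psi>'_def PP')
  qed
  have "germ_inverse \<psi>' \<phi>'" "germ_inverse \<phi>' \<psi>'"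
    using lin inv1 inv2 by (auto simp: germ_inverse_def germ_eq_def)
  hence diffs: "diff_germ \<phi>'" "diff_germ \<psi>'" "germ_inverse \<psi>' \<phi>'"
    using lin by (auto simp: diff_germ_def)
  have roots: "\<exists>r. root_of_unity_order (\<xi> j) (p ^ r)" for j using assms(5) P(4) by blast
  have \<phi>F: "germ_eq (\<phi> \<circ> ?F) (a \<circ> \<phi>)"
  proof -
    have "germ_eq (\<phi> \<circ> ?F) (\<Lambda> \<circ> ?F)" by (rule germ_eq_comp_right[OF \<phi>(1) holo_near0_tendsto[OF F(2,1)]])
    also note \<Lambda>(4)
    also have "germ_eq (a \<circ> \<Lambda>) (a \<circ> \<phi>)" using germ_eq_sym[OF \<phi>(1)] by (rule germ_eq_comp_left)
    finally show ?thesis .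
  qed
  have \<phi>Fk: "germ_eq (\<phi> \<circ> (?F ^^ k)) ((a ^^ k) \<circ> \<phi>)" for k
  proof (induction k)
    case 0
    show ?case by (simp add: germ_eq_refl)
  next
    case (Suc k)
    have "germ_eq ((\<phi> \<circ> ?F) \<circ> (?F ^^ k)) ((a \<circ> \<phi>) \<circ> (?F ^^ k))"
      by (rule germ_eq_comp_right[OF \<phi>F holo_near0_tendsto[OF Fk(2,1)]])
    also have "germ_eq ((a \<circ> \<phi>) \<circ> (?F ^^ k)) (a \<circ> ((a ^^ k) \<circ> \<phi>))"
      unfolding o_assoc[symmetric] using Suc by (rule germ_eq_comp_left)
    finally show ?case unfolding funpow.simps o_assoc .
  qed
  have diag: "P' *v ((a ^^ k) (P *v x)) = (diag_map \<xi> ^^ k) x" for k x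
  proof -
    have "(a ^^ k) (P *v x) = P *v ((diag_map \<xi> ^^ k) x)" by (induction k) (simp_all add: P(3))
    thus ?thesis by (simp add: PP')
  qed
  have lim\<psi>': "filterlim \<psi>' (nhds 0) (nhds 0)" using holo_near0_tendsto[OF lin(4,3)] .
  have lim\<phi>': "filterlim \<phi>' (nhds 0) (nhds 0)" using holo_near0_tendsto[OF lin(2,1)] .
  have model: "germ_eq (\<phi>' \<circ> (?F ^^ k) \<circ> \<psi>') (diag_map \<xi> ^^ k)" for k
  proof -
    have 1: "\<forall>\<^sub>F x in nhds 0. \<phi> ((?F ^^ k) (\<psi>' x)) = (a ^^ k) (\<phi> (\<psi>' x))"
      using germ_eq_comp_right[OF \<phi>Fk lim\<psi>', of k] by (simp add: germ_eq_def)
    have 2: "\<forall>\<^sub>F x in nhds 0. \<phi> (\<psi>' x) = P *v x"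
      using germ_eq_comp_right[OF \<phi>\<psi> limP] by (simp add: germ_eq_def \<psi>'_def)
    from 1 2 show ?thesis unfolding germ_eq_def
      by eventually_elim (simp add: \<phi>'_def diag)
  qed
  have "g \<in> G \<longleftrightarrow> (\<exists>k. germ_eq (\<phi>' \<circ> g \<circ> \<psi>') (diag_map \<xi> ^^ k))" for g
  proof
    assume "g \<in> G"
    then obtain k where "germ_eq g (?F ^^ k)" using G_iff by blast
    hence "germ_eq (\<phi>' \<circ> g \<circ> \<psi>') (\<phi>' \<circ> (?F ^^ k) \<circ> \<psi>')"
      by (intro germ_eq_comp_right germ_eq_comp_left lim\<psi>')
    from germ_eq_trans[OF this model] show "\<exists>k. germ_eq (\<phi>' \<circ> g \<circ> \<psi>') (diag_map \<xi> ^^ k)" by blast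
  next
    assume "\<exists>k. germ_eq (\<phi>' \<circ> g \<circ> \<psi>') (diag_map \<xi> ^^ k)"
    then obtain k where "germ_eq (\<phi>' \<circ> g \<circ> \<psi>') (diag_map \<xi> ^^ k)" by blast
    from germ_eq_trans[OF this germ_eq_sym[OF model]]
    have eq: "\<forall>\<^sub>F x in nhds 0. \<phi>' (g (\<psi>' x)) = \<phi>' ((?F ^^ k) (\<psi>' x))" by (simp add: germ_eq_def)
    \<comment> \<open>Here \<open>g\<close> is an arbitrary function, possibly not continuous. The
      values \<open>\<phi> ((?F ^^ k) (\<psi>' x))\<close> tend to 0 and so drop below
      \<open>\<delta>\<close>; by \<open>eq\<close> the same bound holds for
      \<open>\<phi> (g (\<psi>' x))\<close>, so \<open>\<psi>\<close> cancels \<open>\<phi>\<close>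
      on both sides.\<close>
    have lim: "filterlim (\<lambda>x. \<phi> ((?F ^^ k) (\<psi>' x))) (nhds 0) (nhds 0)"
      by (rule filterlim_compose[OF holo_near0_tendsto[OF \<phi>_holo \<phi>0]
           filterlim_compose[OF holo_near0_tendsto[OF Fk(2,1)] lim\<psi>']])
    have small: "\<forall>\<^sub>F x in nhds 0. norm (\<phi> ((?F ^^ k) (\<psi>' x))) < \<delta>"
      using order_tendstoD(2)[OF tendsto_norm[OF lim]] \<phi>(3) by simp
    from eq small have "germ_eq (g \<circ> \<psi>') ((?F ^^ k) \<circ> \<psi>')" unfolding germ_eq_def
    proof eventually_elim
      case (elim x)
      have "P *v (P' *v \<phi> (g (\<psi>' x))) = P *v (P' *v \<phi> ((?F ^^ k) (\<psi>' x)))"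
        using elim(1) by (simp add: \<phi>'_def)
      hence e: "\<phi> (g (\<psi>' x)) = \<phi> ((?F ^^ k) (\<psi>' x))" by (simp only: PP')
      have "\<psi> (\<phi> (g (\<psi>' x))) = g (\<psi>' x)" by (rule \<phi>(4)) (simp only: e elim(2))
      moreover have "\<psi> (\<phi> ((?F ^^ k) (\<psi>' x))) = (?F ^^ k) (\<psi>' x)" by (rule \<phi>(4)[OF elim(2)])
      ultimately show ?case unfolding e comp_apply by (rule trans[OF sym])
    qed
    from germ_eq_comp_right[OF this lim\<phi>']
    have "germ_eq g (?F ^^ k)" using inv1 unfolding germ_eq_def by eventually_elim simp
    thus "g \<in> G" using G_iff by blast
  qed
  thus ?thesis using diffs roots by blast
qed

end
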